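(* The Hilbert--Poincaré series $\sum_{N\geqslant0}\dim\Lambda^{\mathrm{aff}}(1|1)^N q^N$ of the algebra $\Lambda^{\mathrm{aff}}(1|1)$ of affine supersymmetric polynomials is given by $$\frac{1}{(q)_\infty}\sum_{k=0}^{\infty}\frac{q^{k^2+k}}{(q)_k^2},\qquad (q)_k=\prod_{i=1}^k(1-q^i),\quad (q)_\infty=\prod_{i=1}^\infty(1-q^i).$$ Moreover, this series coincides with the generating function of the plane partitions over the $(1,1)$-hook (in which the coefficient of $q^N$ is the number of such plane partitions with $N$ unit cubes), and so equals $$\frac{1}{(q)_\infty^2}\sum_{k=0}^\infty(-1)^kq^{\frac{k^2+k}{2}}.$$
   Context: Supersymmetric polynomials: $\Lambda(1|1)$ is the algebra of polynomials $P(u,v)\in\mathbb C[u,v]$ such that the result of the substitution $u=t$, $v=-t$ is independent of $t$. For $P\in\Lambda(1|1)$, substitute $u\mapsto u(z)=\sum_{r\geqslant0}u_rz^r$ and $v\mapsto v(z)=\sum_{r\geqslant0}v_rz^r$, where $u_r,v_r$ ($r\geqslant0$) are independent commuting variables, and write $P(u(z),v(z))=\sum_{r\geqslant0}P_rz^r$ with $P_r\in\mathbb C[u_s,v_s\mid s\geqslant0]$. The algebra $\Lambda^{\mathrm{aff}}(1|1)$ is the subalgebra of $\mathbb C[u_s,v_s\mid s\geqslant0]$ generated by all coefficients $P_r$ for all $P\in\Lambda(1|1)$. It is graded by setting $\deg u_r=\deg v_r=r+1$; $\Lambda^{\mathrm{aff}}(1|1)^N$ denotes its homogeneous component of degree $N$,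 with $\Lambda^{\mathrm{aff}}(1|1)^0=\mathbb C$. A plane partition over the $(1,1)$-hook is a finite sequence of (nonempty) Young diagrams $\lambda^{(1)}\supset\dots\supset\lambda^{(r)}$, $r\geqslant0$, with not necessarily strict inclusions, such that each $\lambda^{(i)}$ is a hook diagram $(a,1^b)$ (equivalently, $\lambda^{(1)}$ does not contain the box $(2,2)$). Its number of unit cubes is the total number of boxes $|\lambda^{(1)}|+\dots+|\lambda^{(r)}|$. (The empty sequence has $0$ cubes.) *)

theory Defs
  imports
    "HOL-Analysis.Analysis"
    "HOL-Computational_Algebra.Formal_Power_Series"
    "HOL-Library.Poly_Mapping"
begin

subsection \<open>Polynomials over the complex numbers in commuting variables\<close>

text \<open>A monomial is a finitely supported exponent vector; a polynomial is a finitely supported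
  family of coefficients. Products are the convolution products of \<^theory>\<open>HOL-Library.Poly_Mapping\<close>.\<close>

type_synonym 'v mpoly = "('v \<Rightarrow>\<^sub>0 nat) \<Rightarrow>\<^sub>0 complex"

definition mconst :: "complex \<Rightarrow> 'v mpoly" where
  "mconst c = Poly_Mapping.single 0 c"

definition mvar :: "'v \<Rightarrow> 'v mpoly" where
  "mvar x = Poly_Mapping.single (Poly_Mapping.single x 1) 1"

definition mscale :: "complex \<Rightarrow> 'v mpoly \<Rightarrow> 'v mpoly" where
  "mscale c p = mconst c * p"

lemma vector_space_mscale: "vector_space (mscale :: complex \<Rightarrow> 'v mpoly \<Rightarrow> 'v mpoly)"
  by unfold_locales
    (simp_all add: mscale_def mconst_def distrib_left distrib_right single_add mult_single
      flip: mult.assoc)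

text \<open>Substitution of elements \<open>f x\<close> of a commutative complex algebra for the variables, where
  \<open>\<iota>\<close> is the structure map of that algebra.\<close>

definition msubst :: "(complex \<Rightarrow> 'r::comm_ring_1) \<Rightarrow> ('v \<Rightarrow> 'r) \<Rightarrow> 'v mpoly \<Rightarrow> 'r" where
  "msubst \<iota> f P = (\<Sum>m\<in>Poly_Mapping.keys P. \<iota> (Poly_Mapping.lookup P m) *
      (\<Prod>x\<in>Poly_Mapping.keys m. f x ^ Poly_Mapping.lookup m x))"

definition wdegree :: "('v \<Rightarrow> nat) \<Rightarrow> ('v \<Rightarrow>\<^sub>0 nat) \<Rightarrow> nat" where
  "wdegree w m = (\<Sum>x\<in>Poly_Mapping.keys m. Poly_Mapping.lookup m x * w x)"

definition homogeneous :: "('v \<Rightarrow> nat) \<Rightarrow> nat \<Rightarrow> 'v mpoly \<Rightarrow> bool" where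
  "homogeneous w N p \<longleftrightarrow> (\<forall>m\<in>Poly_Mapping.keys p. wdegree w m = N)"


subsection \<open>Supersymmetric and affine supersymmetric polynomials\<close>

datatype uv = U | V

text \<open>After \<open>u = t\<close>, \<open>v = -t\<close> the result, as a polynomial in \<open>t\<close>, is a constant.\<close>

definition supersym :: "uv mpoly set" where
  "supersym = {P. \<exists>c. msubst (\<lambda>a. [:a:]) (\<lambda>x. case x of U \<Rightarrow> [:0, 1:] | V \<Rightarrow> - [:0, 1:]) P = [:c:]}"

text \<open>The pairs \<open>(U, r)\<close> and \<open>(V, r)\<close> index the variables written \<open>u\<^sub>r\<close> and \<open>v\<^sub>r\<close>.\<close>

definition gen_series :: "uv \<Rightarrow> (uv \<times> nat) mpoly fps" where
  "gen_series x = Abs_fps (\<lambda>r. mvar (x, r))"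

definition affine_coeff :: "uv mpoly \<Rightarrow> nat \<Rightarrow> (uv \<times> nat) mpoly" where
  "affine_coeff P r = fps_nth (msubst (\<lambda>a. fps_const (mconst a)) gen_series P) r"

inductive_set affine_supersym :: "(uv \<times> nat) mpoly set" where
  gen: "P \<in> supersym \<Longrightarrow> affine_coeff P r \<in> affine_supersym"
| const: "mconst c \<in> affine_supersym"
| add: "p \<in> affine_supersym \<Longrightarrow> p' \<in> affine_supersym \<Longrightarrow> p + p' \<in> affine_supersym"
| mult: "p \<in> affine_supersym \<Longrightarrow> p' \<in> affine_supersym \<Longrightarrow> p * p' \<in> affine_supersym"

definition affine_supersym_component :: "nat \<Rightarrow> (uv \<times> nat) mpoly set" where
  "affine_supersym_component N = {p \<in> affine_supersym. homogeneous (\<lambda>(x, r). r + 1) N p}"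

text \<open>The components are finite-dimensional, as all variables have positive degree and only two
  of them have any given degree; so the value \<open>0\<close> that the library dimension takes on
  infinite-dimensional spaces does not interfere.\<close>

definition hilbert_series :: "rat fps" where
  "hilbert_series = Abs_fps (\<lambda>N. of_nat (vector_space.dim mscale (affine_supersym_component N)))"


subsection \<open>Plane partitions over the (1,1)-hook\<close>

text \<open>Boxes are pairs (row, column), both counted from 1.\<close>

definition young_diagram :: "nat list \<Rightarrow> (nat \<times> nat) set" where
  "young_diagram ps = {(i, j). 1 \<le> i \<and> i \<le> length ps \<and> 1 \<le> j \<and> j \<le> ps ! (i - 1)}"

definition hook_diagram :: "(nat \<times> nat) set \<Rightarrow> bool" where
  "hook_diagram D \<longleftrightarrow> (\<exists>a b. a \<ge> 1 \<and> D = young_diagram (a # replicate b 1))"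

definition hook_plane_partition :: "(nat \<times> nat) set list \<Rightarrow> bool" where
  "hook_plane_partition Ds \<longleftrightarrow> (\<forall>D\<in>set Ds. hook_diagram D) \<and> sorted_wrt (\<lambda>D E. D \<supseteq> E) Ds"

definition num_cubes :: "(nat \<times> nat) set list \<Rightarrow> nat" where
  "num_cubes Ds = (\<Sum>D\<leftarrow>Ds. card D)"

definition plane_partition_series :: "rat fps" where
  "plane_partition_series =
     Abs_fps (\<lambda>N. of_nat (card {Ds. hook_plane_partition Ds \<and> num_cubes Ds = N}))"


subsection \<open>The symbols \<open>(q)\<^sub>k\<close> and \<open>(q)\<^sub>\<infinity>\<close>\<close>

text \<open>Infinite sums and products of power series are limits in the topology of the library on
  formal power series, which is the topology given by powers of \<open>q\<close>.\<close>

definition qpoch :: "nat \<Rightarrow> rat fps" where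
  "qpoch k = (\<Prod>i=1..k. 1 - fps_X ^ i)"

definition qpoch_inf :: "rat fps" where
  "qpoch_inf = prodinf (\<lambda>i. 1 - fps_X ^ (i + 1))"

lemma fps_nth_one_minus_X_power_mult:
  fixes f :: "rat fps"
  assumes "n < m"
  shows "fps_nth (f * (1 - fps_X ^ m)) n = fps_nth f n"
  using assms by (simp add: algebra_simps fps_X_power_mult_right_nth)

lemma fps_nth_qpoch: "n \<le> k \<Longrightarrow> fps_nth (qpoch k) n = fps_nth (qpoch n) n"
proof (induction k rule: dec_induct)
  case (step k)
  have "qpoch (Suc k) = qpoch k * (1 - fps_X ^ Suc k)"
    by (simp add: qpoch_def)
  then show ?case
    using step fps_nth_one_minus_X_power_mult[of n "Suc k" "qpoch k"] by simp
qed simp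

lemma qpoch_tendsto: "qpoch \<longlonglongrightarrow> Abs_fps (\<lambda>n. fps_nth (qpoch n) n)"
proof (rule tendsto_fpsI)
  show "\<forall>\<^sub>F k in sequentially. fps_nth (qpoch k) n =
      fps_nth (Abs_fps (\<lambda>n. fps_nth (qpoch n) n)) n" for n
    by (rule eventually_sequentiallyI[of n]) (unfold fps_nth_Abs_fps, rule fps_nth_qpoch)
qed

lemma qpoch_inf_has_prod: "(\<lambda>i. 1 - fps_X ^ (i + 1) :: rat fps) has_prod qpoch_inf"
  and qpoch_tendsto_inf: "qpoch \<longlonglongrightarrow> qpoch_inf"
proof -
  define L where "L = Abs_fps (\<lambda>n. fps_nth (qpoch n) n)"
  have eq: "(\<Prod>i\<le>n. 1 - fps_X ^ (i + 0 + 1)) = qpoch (Suc n)" for n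
    unfolding qpoch_def by (rule prod.reindex_bij_witness[of _ "\<lambda>i. i - 1" Suc]) auto
  have "fps_nth L 0 = 1"
    by (simp add: L_def qpoch_def)
  then have "L \<noteq> 0"
    by auto
  moreover have "(\<lambda>n. qpoch (Suc n)) \<longlonglongrightarrow> L"
    using qpoch_tendsto unfolding L_def by (rule LIMSEQ_Suc)
  ultimately have "raw_has_prod (\<lambda>i. 1 - fps_X ^ (i + 1) :: rat fps) 0 L"
    unfolding raw_has_prod_def eq by simp
  then have prod: "(\<lambda>i. 1 - fps_X ^ (i + 1) :: rat fps) has_prod L"
    by (simp add: has_prod_def)
  then have L: "qpoch_inf = L"
    unfolding qpoch_inf_def by (rule has_prod_unique[symmetric])
  show "(\<lambda>i. 1 - fps_X ^ (i + 1) :: rat fps) has_prod qpoch_inf"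
    and "qpoch \<longlonglongrightarrow> qpoch_inf"
    using prod qpoch_tendsto unfolding L by (simp_all add: L_def)
qed

lemma summable_fpsI:
  fixes f :: "nat \<Rightarrow> rat fps"
  assumes "\<And>k n. n < k \<Longrightarrow> fps_nth (f k) n = 0"
  shows "summable f"
proof -
  have "(\<lambda>m. \<Sum>k<m. f k) \<longlonglongrightarrow> Abs_fps (\<lambda>n. \<Sum>k\<le>n. fps_nth (f k) n)"
  proof (rule tendsto_fpsI)
    fix n
    have "fps_nth (\<Sum>k<m. f k) n = (\<Sum>k\<le>n. fps_nth (f k) n)" if "Suc n \<le> m" for m
      unfolding fps_sum_nth
      by (rule sum.mono_neutral_right) (use that assms in auto)
    then show "\<forall>\<^sub>F m in sequentially. fps_nth (\<Sum>k<m. f k) n =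
        fps_nth (Abs_fps (\<lambda>n. \<Sum>k\<le>n. fps_nth (f k) n)) n"
      by (intro eventually_sequentiallyI[of "Suc n"]) simp
  qed
  then show ?thesis
    by (auto simp: summable_def sums_def)
qed

lemma summable_hook_sum: "summable (\<lambda>k. fps_X ^ (k ^ 2 + k) / qpoch k ^ 2)"
proof (rule summable_fpsI)
  fix k n :: nat
  assume "n < k"
  then have lt: "n < k ^ 2 + k"
    by simp
  have "fps_nth (qpoch k ^ 2) 0 = 1"
    using fps_nth_qpoch[of 0 k] by (simp add: qpoch_def power2_eq_square)
  then have "fps_X ^ (k ^ 2 + k) / qpoch k ^ 2 = fps_X ^ (k ^ 2 + k) * inverse (qpoch k ^ 2)"
    by (intro fps_divide_unit) simp
  then show "fps_nth (fps_X ^ (k ^ 2 + k) / qpoch k ^ 2) n = 0"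
    using lt by (simp add: fps_X_power_mult_nth)
qed

lemma summable_alternating_sum: "summable (\<lambda>k. (- 1) ^ k * fps_X ^ ((k ^ 2 + k) div 2) :: rat fps)"
proof (rule summable_fpsI)
  fix k n :: nat
  assume "n < k"
  then have "k * 2 \<le> k ^ 2 + k"
    by (cases k) (auto simp: power2_eq_square)
  then have "k \<le> (k ^ 2 + k) div 2"
    by linarith
  then show "fps_nth ((- 1) ^ k * fps_X ^ ((k ^ 2 + k) div 2) :: rat fps) n = 0"
    using \<open>n < k\<close> by (simp add: fps_X_power_mult_right_nth)
qed

end

theory Submission
  imports Defs
begin

text \<open>
  With \<open>x = u\<close> and \<open>p = u + v\<close>, a polynomial is constant on the line \<open>u = t\<close>, \<open>v = -t\<close> iff all its
  nonconstant monomials in \<open>x\<close>, \<open>p\<close> contain \<open>p\<close>. So the algebra in question is generated by the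
  coefficients of the series \<open>p(z) x(z)\<^sup>a\<close>, \<open>a \<ge> 0\<close>, and it splits according to the number \<open>k\<close> of
  factors \<open>p\<close>. Write \<open>A\<^sub>k\<close> for the part spanned by products of \<open>k\<close> such coefficients.

  The coefficients of \<open>\<Prod>\<^sub>i p(z\<^sub>i) exp(w\<^sub>i x(z\<^sub>i))\<close>, \<open>1 \<le> i \<le> k\<close>, span \<open>A\<^sub>k\<close>, and the exponents
  add up to \<open>\<Sum>\<^sub>r \<pi>\<^sub>r x\<^sub>r\<close> with \<open>\<pi>\<^sub>r = \<Sum>\<^sub>i w\<^sub>i z\<^sub>i\<^sup>r\<close>. So the graded dual of \<open>A\<^sub>k\<close> is the algebra generated by
  the symmetric polynomials in \<open>z\<close> and the polarised power sums \<open>\<pi>\<^sub>r\<close>. Newton's recursion expresses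
  \<open>\<pi>\<^sub>r\<close>, \<open>r \<ge> k\<close>, through \<open>\<pi>\<^sub>0, \<dots>, \<pi>\<^sub>k\<^sub>-\<^sub>1\<close>, and the latter are independent since the Vandermonde
  determinant does not vanish. In other words, an element of \<open>A\<^sub>k\<close> is determined by its coefficients
  at the monomials whose variables \<open>x\<^sub>r\<close> all satisfy \<open>r < k\<close>, and these coefficients are arbitrary.

  Both halves of this statement are proved directly on \<open>A\<^sub>k\<close>. For the first one
  (\<open>gen_span_eq_0I\<close>), Newton's recursion becomes an identity between the derivations \<open>\<partial>/\<partial>x\<^sub>r\<close>, which
  preserve \<open>A\<^sub>k\<close>: if the first \<open>k\<close> of them annihilate an element, all of them do
  (\<open>pdiff_determined\<close>), and an induction on the degree in \<open>x\<close> applies. For the second one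
  (\<open>standard_monomial_lift\<close>), products of the series \<open>p(z) x(z)\<^sup>a\<close> are evaluated at \<open>k\<close> distinct complex
  numbers \<open>z\<close>, and an inverse Vandermonde matrix isolates one variable \<open>x\<^sub>r\<close> or \<open>p\<^sub>l\<close> after the other.

  Counting monomials gives the Hilbert series \<open>\<Sum>\<^sub>k q\<^sup>k / (q)\<^sub>k\<^sup>2\<close>. A sequence of \<open>k\<close> nested hooks is a
  pair of weakly decreasing sequences of length \<open>k\<close>, the arms and the legs, so plane partitions
  over the hook have the same generating function. Two classical expansions turn this sum into the
  two stated forms: the Durfee rectangle identity (\<open>durfee_rectangle\<close>), and Euler's expansions of
  \<open>(q\<^sup>k\<^sup>+\<^sup>1; q)\<^sub>\<infinity>\<close> and its inverse (\<open>euler_sum\<close>, \<open>euler_sum_inverse\<close>).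
\<close>

section \<open>Infinite sums of formal power series\<close>

text \<open>All series below satisfy the condition that the \<open>k\<close>-th term is divisible by \<open>q\<^sup>k\<close>. Then each
  coefficient of the sum is a finite sum, and the rules for rearranging are rules for finite
  sums.\<close>

abbreviation null_tail :: "(nat \<Rightarrow> rat fps) \<Rightarrow> bool" where
  "null_tail f \<equiv> \<forall>k n. n < k \<longrightarrow> fps_nth (f k) n = 0"

lemma fps_nth_suminf:
  assumes "null_tail f"
  shows "fps_nth (suminf f) n = (\<Sum>k\<le>n. fps_nth (f k) n)"
proof -
  have "(\<lambda>m. \<Sum>k<m. f k) \<longlonglongrightarrow> Abs_fps (\<lambda>n. \<Sum>k\<le>n. fps_nth (f k) n)"
  proof (rule tendsto_fpsI)
    fix n
    have "fps_nth (\<Sum>k<m. f k) n = (\<Sum>k\<le>n. fps_nth (f k) n)" if "Suc n \<le> m" for m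
      unfolding fps_sum_nth
      by (rule sum.mono_neutral_right) (use that assms in auto)
    then show "\<forall>\<^sub>F m in sequentially. fps_nth (\<Sum>k<m. f k) n =
        fps_nth (Abs_fps (\<lambda>n. \<Sum>k\<le>n. fps_nth (f k) n)) n"
      by (intro eventually_sequentiallyI[of "Suc n"]) simp
  qed
  then have "f sums Abs_fps (\<lambda>n. \<Sum>k\<le>n. fps_nth (f k) n)"
    by (simp add: sums_def)
  then show ?thesis
    by (simp add: sums_unique[symmetric])
qed

lemma fps_nth_suminf_le:
  assumes "null_tail f" "n \<le> m"
  shows "fps_nth (suminf f) n = (\<Sum>k\<le>m. fps_nth (f k) n)"
  unfolding fps_nth_suminf[OF assms(1)]
  by (rule sum.mono_neutral_left) (use assms in auto)

lemma null_tail_mult: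
  assumes "null_tail f"
  shows "null_tail (\<lambda>k. c k * f k)"
proof (intro allI impI)
  fix k n :: nat
  assume "n < k"
  then have "fps_nth (c k) i * fps_nth (f k) (n - i) = 0" for i
    using assms by simp
  then show "fps_nth (c k * f k) n = 0"
    unfolding fps_mult_nth by (intro sum.neutral ballI)
qed

lemma suminf_fps_cmult:
  assumes "null_tail f"
  shows "suminf (\<lambda>k. c * f k) = c * suminf f"
proof (rule fps_ext)
  fix n
  have "fps_nth (suminf (\<lambda>k. c * f k)) n = (\<Sum>k\<le>n. \<Sum>i=0..n. fps_nth c i * fps_nth (f k) (n - i))"
    using null_tail_mult[OF assms, of "\<lambda>_. c"] by (subst fps_nth_suminf) (auto simp: fps_mult_nth)
  also have "\<dots> = (\<Sum>i=0..n. fps_nth c i * (\<Sum>k\<le>n. fps_nth (f k) (n - i)))"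
    by (subst sum.swap) (simp add: sum_distrib_left)
  also have "\<dots> = fps_nth (c * suminf f) n"
    unfolding fps_mult_nth
    by (intro sum.cong refl arg_cong2[of _ _ _ _ "(*)"] fps_nth_suminf_le[OF assms, symmetric]) simp
  finally show "fps_nth (suminf (\<lambda>k. c * f k)) n = fps_nth (c * suminf f) n" .
qed

lemma suminf_fps_diff:
  assumes "null_tail f" "null_tail g"
  shows "suminf (\<lambda>k. f k - g k) = suminf f - suminf g"
  using assms by (intro fps_ext) (simp add: fps_nth_suminf sum_subtractf)

lemma suminf_fps_shift:
  assumes "null_tail f"
  shows "suminf f = f 0 + suminf (\<lambda>k. f (Suc k))"
proof (rule fps_ext)
  fix n
  have "fps_nth (suminf f) n = (\<Sum>k\<le>Suc n. fps_nth (f k) n)"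
    using assms by (intro fps_nth_suminf_le) auto
  also have "\<dots> = fps_nth (f 0) n + (\<Sum>k\<le>n. fps_nth (f (Suc k)) n)"
    by (subst sum.atMost_Suc_shift) simp
  also have "\<dots> = fps_nth (f 0 + suminf (\<lambda>k. f (Suc k))) n"
    using assms by (subst fps_add_nth, subst fps_nth_suminf) auto
  finally show "fps_nth (suminf f) n = fps_nth (f 0 + suminf (\<lambda>k. f (Suc k))) n" .
qed

lemma suminf_fps_swap:
  fixes f :: "nat \<Rightarrow> nat \<Rightarrow> rat fps"
  assumes "\<And>j k n. n < j \<or> n < k \<Longrightarrow> fps_nth (f j k) n = 0"
  shows "suminf (\<lambda>j. suminf (f j)) = suminf (\<lambda>k. suminf (\<lambda>j. f j k))"
proof (rule fps_ext)
  fix n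
  have 1: "null_tail (f j)" "null_tail (\<lambda>j. f j k)" for j k
    using assms by auto
  have 2: "null_tail (\<lambda>j. suminf (f j))" "null_tail (\<lambda>k. suminf (\<lambda>j. f j k))"
    using assms by (auto simp: fps_nth_suminf[OF 1(1)] fps_nth_suminf[OF 1(2)])
  show "fps_nth (suminf (\<lambda>j. suminf (f j))) n = fps_nth (suminf (\<lambda>k. suminf (\<lambda>j. f j k))) n"
    unfolding fps_nth_suminf[OF 2(1)] fps_nth_suminf[OF 2(2)] fps_nth_suminf[OF 1(1)]
      fps_nth_suminf[OF 1(2)]
    by (rule sum.swap)
qed

section \<open>Expansions of Euler and Durfee\<close>

abbreviation invq :: "nat \<Rightarrow> rat fps" where "invq k \<equiv> inverse (qpoch k)"

lemma qpoch_nth_0 [simp]: "fps_nth (qpoch k) 0 = 1"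
  using fps_nth_qpoch[of 0 k] by (simp add: qpoch_def)

lemma qpoch_inf_nth: "fps_nth qpoch_inf n = fps_nth (qpoch n) n"
  using LIMSEQ_unique[OF qpoch_tendsto_inf qpoch_tendsto] by (metis fps_nth_Abs_fps)

lemma qpoch_inf_nth_0 [simp]: "fps_nth qpoch_inf 0 = 1"
  by (simp add: qpoch_inf_nth)

lemma invq_qpoch [simp]: "invq k * qpoch k = 1" "qpoch k * invq k = 1"
  by (simp_all add: inverse_mult_eq_1 inverse_mult_eq_1')

lemma invq_inf [simp]: "inverse qpoch_inf * qpoch_inf = 1" "qpoch_inf * inverse qpoch_inf = 1"
  by (simp_all add: inverse_mult_eq_1 inverse_mult_eq_1')

lemma qpoch_0 [simp]: "qpoch 0 = 1"
  by (simp add: qpoch_def)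

lemma qpoch_Suc: "qpoch (Suc k) = qpoch k * (1 - fps_X ^ Suc k)"
  by (simp add: qpoch_def)

lemma invq_Suc: "(1 - fps_X ^ Suc k) * invq (Suc k) = invq k"
proof -
  have "(1 - fps_X ^ Suc k) * invq (Suc k) =
      (invq k * qpoch k) * ((1 - fps_X ^ Suc k) * invq (Suc k))"
    by simp
  also have "\<dots> = invq k * (qpoch (Suc k) * invq (Suc k))"
    by (simp only: qpoch_Suc mult_ac)
  finally show ?thesis
    by simp
qed

abbreviation hook_series :: "rat fps" where
  "hook_series \<equiv> suminf (\<lambda>k. fps_X ^ k * (invq k * invq k))"

lemma null_tail_X_power:
  fixes e :: "nat \<Rightarrow> nat"
  assumes "\<And>k. k \<le> e k"
  shows "null_tail (\<lambda>k. fps_X ^ e k * c k)"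
  using assms by (auto simp: fps_X_power_mult_nth) (metis le_trans not_le)

text \<open>A recursion in \<open>k\<close> gives \<open>f k = c (q)\<^sub>k h\<close>; the value of the unknown factor \<open>h\<close> is then found by
  comparing the limits of both sides as \<open>k\<close> grows.\<close>

lemma eq_qpoch_inf_multiple:
  assumes "\<And>k n. n < k \<Longrightarrow> fps_nth (f k) n = fps_nth g n" and "\<And>k. f k = c * qpoch k * h"
  shows "g = c * qpoch_inf * h"
proof (rule fps_ext)
  fix n
  have "fps_nth (qpoch (Suc n)) i = fps_nth qpoch_inf i" if "i \<le> n" for i
    using that fps_nth_qpoch[of i "Suc n"] by (simp add: qpoch_inf_nth)
  then have "fps_nth (qpoch (Suc n) * (c * h)) n = fps_nth (qpoch_inf * (c * h)) n"
    by (simp add: fps_mult_nth)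
  then show "fps_nth g n = fps_nth (c * qpoch_inf * h) n"
    using assms(1)[of n "Suc n"] assms(2)[of "Suc n"] by (simp add: mult_ac)
qed

text \<open>Multiplying the summand by \<open>1 - q\<^sup>k\<close> shifts the summation index, which relates the sums for \<open>j\<close>
  and \<open>j + 1\<close>; as \<open>j\<close> grows, the sum tends to its term \<open>k = 0\<close>.\<close>

lemma euler_sum_inverse: "suminf (\<lambda>k. fps_X ^ (k * Suc j) * invq k) * qpoch_inf = qpoch j"
proof -
  define e where "e j = suminf (\<lambda>k. fps_X ^ (k * Suc j) * invq k)" for j
  have nt: "null_tail (\<lambda>k. fps_X ^ (k * Suc j) * invq k)" for j
    by (rule null_tail_X_power) simp
  have step: "e (Suc j) = (1 - fps_X ^ Suc j) * e j" for j
  proof -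
    have nt': "null_tail (\<lambda>k. fps_X ^ (k * Suc j) * invq k - fps_X ^ (k * Suc (Suc j)) * invq k)"
      using nt[of j] nt[of "Suc j"] by auto
    have "e j - e (Suc j) =
        suminf (\<lambda>k. fps_X ^ (k * Suc j) * invq k - fps_X ^ (k * Suc (Suc j)) * invq k)"
      unfolding e_def by (rule suminf_fps_diff[symmetric]) (rule nt)+
    also have "\<dots> = suminf (\<lambda>k. fps_X ^ (Suc k * Suc j) * invq (Suc k) -
        fps_X ^ (Suc k * Suc (Suc j)) * invq (Suc k))"
      by (subst suminf_fps_shift[OF nt']) simp
    also have "(\<lambda>k. fps_X ^ (Suc k * Suc j) * invq (Suc k) -
        fps_X ^ (Suc k * Suc (Suc j)) * invq (Suc k)) =
        (\<lambda>k. fps_X ^ Suc j * (fps_X ^ (k * Suc j) * invq k))"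
    proof
      fix k
      have "Suc k * Suc (Suc j) = Suc k * Suc j + Suc k" "Suc k * Suc j = Suc j + k * Suc j"
        by simp_all
      then have "fps_X ^ (Suc k * Suc j) * invq (Suc k) - fps_X ^ (Suc k * Suc (Suc j)) * invq (Suc k)
          = fps_X ^ (Suc k * Suc j) * ((1 - fps_X ^ Suc k) * invq (Suc k))"
        by (simp only: power_add) (simp add: algebra_simps)
      also have "\<dots> = fps_X ^ Suc j * (fps_X ^ (k * Suc j) * invq k)"
        unfolding invq_Suc \<open>Suc k * Suc j = Suc j + k * Suc j\<close> power_add by (simp add: mult_ac)
      finally show "fps_X ^ (Suc k * Suc j) * invq (Suc k) -
          fps_X ^ (Suc k * Suc (Suc j)) * invq (Suc k) = \<dots>" .
    qed
    also have "suminf \<dots> = fps_X ^ Suc j * e j"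
      unfolding e_def by (rule suminf_fps_cmult) (rule nt)
    finally show ?thesis
      by (simp add: algebra_simps)
  qed
  have e: "e j = qpoch j * e 0" for j
    by (induction j) (simp_all add: step qpoch_Suc mult_ac)
  have "1 = 1 * qpoch_inf * e 0"
  proof (rule eq_qpoch_inf_multiple)
    fix j n :: nat
    assume "n < j"
    have "fps_nth (e j) n = fps_nth (1 + suminf (\<lambda>k. fps_X ^ Suc j * (fps_X ^ (k * Suc j) * invq (Suc k)))) n"
      unfolding e_def by (subst suminf_fps_shift[OF nt]) (simp add: power_add mult_ac)
    also have "\<dots> = fps_nth (1 + fps_X ^ Suc j * suminf (\<lambda>k. fps_X ^ (k * Suc j) * invq (Suc k))) n"
      by (subst suminf_fps_cmult, rule null_tail_X_power) simp_all
    also have "\<dots> = fps_nth 1 n"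
      using \<open>n < j\<close> by (simp add: fps_X_power_mult_nth del: power_Suc)
    finally show "fps_nth (e j) n = fps_nth 1 n" .
  next
    show "e j = 1 * qpoch j * e 0" for j
      using e[of j] by simp
  qed
  then show ?thesis
    using e[of j] unfolding e_def by (simp add: mult_ac)
qed

lemma triangular_Suc:
  fixes j :: nat
  shows "(Suc j ^ 2 + Suc j) div 2 = Suc j + (j ^ 2 + j) div 2"
proof -
  have "Suc j ^ 2 + Suc j = 2 * Suc j + (j ^ 2 + j)"
    by (simp add: power2_eq_square)
  then show ?thesis
    by presburger
qed

lemma le_triangular:
  fixes j :: nat
  shows "j \<le> (j ^ 2 + j) div 2"
proof (induction j)
  case (Suc j)
  show ?case
    unfolding triangular_Suc by simp
qed simp

text \<open>The same argument as for the previous expansion, with the recursion now going from \<open>k\<close> to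
  \<open>k + 1\<close>.\<close>

lemma euler_sum:
  "suminf (\<lambda>j. (- 1) ^ j * fps_X ^ ((j ^ 2 + j) div 2 + k * j) * invq j) * qpoch k = qpoch_inf"
proof -
  define T where "T k j = (- 1) ^ j * fps_X ^ ((j ^ 2 + j) div 2 + k * j) * invq j" for k j
  define e where "e k = suminf (T k)" for k
  have T: "T k j = fps_X ^ ((j ^ 2 + j) div 2 + k * j) * ((- 1) ^ j * invq j)" for k j
    by (simp add: T_def mult_ac)
  have nt: "null_tail (T k)" for k
    unfolding T using le_triangular by (intro null_tail_X_power trans_le_add1)
  have step: "e k = (1 - fps_X ^ Suc k) * e (Suc k)" for k
  proof -
    have nt': "null_tail (\<lambda>j. T k j - T (Suc k) j)"
      using nt[of k] nt[of "Suc k"] by auto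
    have "e k - e (Suc k) = suminf (\<lambda>j. T k j - T (Suc k) j)"
      unfolding e_def by (rule suminf_fps_diff[symmetric]) (rule nt)+
    also have "\<dots> = suminf (\<lambda>j. T k (Suc j) - T (Suc k) (Suc j))"
      by (subst suminf_fps_shift[OF nt']) (simp add: T_def)
    also have "(\<lambda>j. T k (Suc j) - T (Suc k) (Suc j)) = (\<lambda>j. - (fps_X ^ Suc k) * T (Suc k) j)"
    proof
      fix j
      define A where "A = (Suc j ^ 2 + Suc j) div 2 + k * Suc j"
      have A: "(Suc j ^ 2 + Suc j) div 2 + Suc k * Suc j = A + Suc j"
          "A = Suc k + ((j ^ 2 + j) div 2 + Suc k * j)"
        by (simp_all only: A_def triangular_Suc) simp_all
      have "T k (Suc j) - T (Suc k) (Suc j) =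
          fps_X ^ A * (- 1) ^ Suc j * ((1 - fps_X ^ Suc j) * invq (Suc j))"
        unfolding T A(1) unfolding A_def[symmetric] power_add by (simp add: algebra_simps)
      also have "\<dots> = - (fps_X ^ Suc k) * T (Suc k) j"
        unfolding invq_Suc unfolding T A(2) power_add by (simp add: mult_ac)
      finally show "T k (Suc j) - T (Suc k) (Suc j) = - (fps_X ^ Suc k) * T (Suc k) j" .
    qed
    also have "suminf \<dots> = - (fps_X ^ Suc k) * e (Suc k)"
      unfolding e_def by (rule suminf_fps_cmult) (rule nt)
    finally show ?thesis
      by (simp add: algebra_simps)
  qed
  have e: "e 0 = e k * qpoch k" for k
  proof (induction k)
    case (Suc k)
    then show ?case
      using step[of k] by (simp only: qpoch_Suc mult_ac)
  qed simp
  have "e 0 = 1 * qpoch_inf * 1"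
  proof (rule eq_qpoch_inf_multiple)
    fix k n :: nat
    assume "n < k"
    show "fps_nth (qpoch k) n = fps_nth (e 0) n"
    proof -
      have small: "fps_nth (e k) i = fps_nth 1 i" if "i \<le> n" for i
      proof -
        have "fps_nth (T k (Suc j)) i = 0" for j
          unfolding T fps_X_power_mult_nth using that \<open>n < k\<close> by simp
        then show ?thesis
          using nt[of k] unfolding e_def
          by (subst suminf_fps_shift[OF nt]) (simp add: fps_nth_suminf T_def[of _ 0])
      qed
      have "fps_nth (e 0) n = fps_nth (e k * qpoch k) n"
        using e by simp
      also have "\<dots> = fps_nth (1 * qpoch k) n"
        unfolding fps_mult_nth by (rule sum.cong) (simp_all add: small)
      finally show ?thesis by simp
    qed
  qed simp
  then have "e k * qpoch k = qpoch_inf"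
    using e[of k] by simp
  then show ?thesis
    by (simp only: e_def T_def[abs_def])
qed

text \<open>A partition with at most \<open>n + j\<close> parts is cut along the largest rectangle of \<open>k + j\<close> rows and \<open>k\<close>
  columns inside its diagram; the resulting identity for \<open>1 / (q)\<^sub>n\<^sub>+\<^sub>j\<close> is divided by \<open>(q)\<^sub>n\<close>.

  In the proof \<open>b\<close> is the Gaussian binomial coefficient and \<open>S n j\<close> the sum for \<open>1 / (q)\<^sub>n\<^sub>+\<^sub>j\<close>. Pascal's
  rule splits \<open>S (n + 1) j\<close> into two sums. In the second one \<open>1 / (q)\<^sub>k\<^sub>+\<^sub>j\<close> is
  \<open>(1 - q\<^sup>k\<^sup>+\<^sup>j\<^sup>+\<^sup>1) / (q)\<^sub>k\<^sub>+\<^sub>j\<^sub>+\<^sub>1\<close>, and the correction term cancels the first sum, which leaves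
  \<open>S n (j + 1)\<close>.\<close>

lemma durfee_rectangle:
  "(\<Sum>k\<le>n. fps_X ^ (k * (k + j)) * invq k * invq (n - k) * invq (k + j)) = invq n * invq (n + j)"
proof -
  define b where "b n k = (if k \<le> n then qpoch n * invq k * invq (n - k) else 0)" for n k
  have pascal: "b (Suc n) k = (if k = 0 then 0 else b n (k - 1)) + fps_X ^ k * b n k" for n k
  proof -
    consider "k = 0" | "k = Suc n" | l where "k = Suc l" "l < n" | "k > Suc n"
      by (metis less_Suc_eq not_less_eq not0_implies_Suc)
    then show ?thesis
    proof cases
      case 3
      then obtain m where m: "n = Suc (l + m)"
        using less_iff_Suc_add by blast
      have b: "b (Suc n) k = qpoch (Suc n) * invq k * invq (Suc m)"
        "(if k = 0 then 0 else b n (k - 1)) = qpoch n * invq l * invq (Suc m)"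
        "b n k = qpoch n * invq k * invq m"
        using 3 m by (simp_all add: b_def Suc_diff_le)
      have 3: "fps_X ^ Suc n = (fps_X ^ k * fps_X ^ Suc m :: rat fps)"
        by (simp add: m \<open>k = Suc l\<close> power_add)
      have 4: "invq l = (1 - fps_X ^ k) * invq k" "invq m = (1 - fps_X ^ Suc m) * invq (Suc m)"
        by (simp_all only: invq_Suc \<open>k = Suc l\<close>)
      have "qpoch (Suc n) * invq k * invq (Suc m) = qpoch n * ((1 - fps_X ^ k) * invq k) * invq (Suc m) +
          fps_X ^ k * (qpoch n * invq k * ((1 - fps_X ^ Suc m) * invq (Suc m)))"
        unfolding qpoch_Suc[of n] 3 by (simp only: algebra_simps mult_1_left mult_1_right)
      then show ?thesis
        unfolding 4[symmetric] b by simp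
    next
      case 1
      then show ?thesis by (simp add: b_def)
    next
      case 2
      then show ?thesis by (simp add: b_def)
    next
      case 4
      then have "\<not> k \<le> Suc n" "\<not> k - 1 \<le> n" "\<not> k \<le> n" by simp_all
      then show ?thesis by (simp add: b_def)
    qed
  qed
  define S where "S n j = (\<Sum>k\<le>n. fps_X ^ (k * (k + j)) * b n k * invq (k + j))" for n j
  have Sext: "S n j = (\<Sum>k\<le>Suc n. fps_X ^ (k * (k + j)) * b n k * invq (k + j))" for n j
    by (simp add: S_def b_def)
  have step: "S (Suc n) j = S n (Suc j)" for n j
  proof -
    define c where "c k = fps_X ^ (Suc k * (Suc k + j)) * b n k * invq (Suc k + j)" for k
    have "S (Suc n) j =
        (\<Sum>k\<le>Suc n. fps_X ^ (k * (k + j)) * (if k = 0 then 0 else b n (k - 1)) * invq (k + j)) +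
        (\<Sum>k\<le>Suc n. fps_X ^ (k * (k + j) + k) * b n k * invq (k + j))"
      by (simp only: S_def pascal distrib_left distrib_right sum.distrib power_add mult_ac)
    also have "(\<Sum>k\<le>Suc n. fps_X ^ (k * (k + j)) * (if k = 0 then 0 else b n (k - 1)) * invq (k + j)) =
        (\<Sum>k\<le>n. c k)"
      by (subst sum.atMost_Suc_shift) (simp add: c_def)
    also have "(\<Sum>k\<le>n. c k) = (\<Sum>k\<le>Suc n. c k)"
      by (simp add: c_def b_def)
    also have "(\<Sum>k\<le>Suc n. c k) + (\<Sum>k\<le>Suc n. fps_X ^ (k * (k + j) + k) * b n k * invq (k + j)) =
        (\<Sum>k\<le>Suc n. fps_X ^ (k * (k + Suc j)) * b n k * invq (k + Suc j))"
      unfolding sum.distrib[symmetric]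
    proof (rule sum.cong[OF refl])
      fix k
      have 1: "Suc k * (Suc k + j) = k * (k + Suc j) + Suc (k + j)" "k * (k + j) + k = k * (k + Suc j)"
        by simp_all
      show "c k + fps_X ^ (k * (k + j) + k) * b n k * invq (k + j) =
          fps_X ^ (k * (k + Suc j)) * b n k * invq (k + Suc j)"
        unfolding c_def 1 power_add invq_Suc[of "k + j", symmetric] by (simp add: algebra_simps)
    qed
    finally show ?thesis
      by (simp only: Sext)
  qed
  have S: "S n j = invq (n + j)"
  proof (induction n arbitrary: j)
    case 0
    then show ?case by (simp add: S_def b_def)
  next
    case (Suc n)
    then show ?case by (simp add: step)
  qed
  have "invq n * S n j =
      (\<Sum>k\<le>n. fps_X ^ (k * (k + j)) * invq k * invq (n - k) * invq (k + j))"
    unfolding S_def sum_distrib_left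
  proof (rule sum.cong[OF refl])
    fix k assume "k \<in> {..n}"
    have "invq n * (fps_X ^ (k * (k + j)) * b n k * invq (k + j)) =
        (invq n * qpoch n) * (fps_X ^ (k * (k + j)) * invq k * invq (n - k) * invq (k + j))"
      using \<open>k \<in> {..n}\<close> unfolding b_def by (simp only: if_True atMost_iff mult_ac)
    then show "invq n * (fps_X ^ (k * (k + j)) * b n k * invq (k + j)) =
        fps_X ^ (k * (k + j)) * invq k * invq (n - k) * invq (k + j)"
      by simp
  qed
  then show ?thesis
    by (simp add: S)
qed

text \<open>One of the two factors \<open>1 / (q)\<^sub>k\<close> is expanded by \<open>euler_sum\<close>; in the double sum, the sum over
  \<open>k\<close> is then evaluated by \<open>euler_sum_inverse\<close>.\<close>

lemma hook_series_eq_alternating: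
  "hook_series =
    1 / qpoch_inf ^ 2 * suminf (\<lambda>k. (- 1) ^ k * fps_X ^ ((k ^ 2 + k) div 2))"
proof -
  define t :: "nat \<Rightarrow> rat fps" where "t j = (- 1) ^ j * fps_X ^ ((j ^ 2 + j) div 2)" for j
  define T :: "nat \<Rightarrow> nat \<Rightarrow> rat fps" where
    "T k j = fps_X ^ ((j ^ 2 + j) div 2 + k * Suc j) * ((- 1) ^ j * invq j * invq k)" for k j
  have ntT: "n < k \<or> n < j \<Longrightarrow> fps_nth (T k j) n = 0" for k j n
    using le_triangular[of j] by (auto simp: T_def fps_X_power_mult_nth)
  have ntt: "null_tail t"
    using le_triangular unfolding t_def by (auto simp: fps_X_power_mult_right_nth) (metis le_trans not_le)
  have rows: "suminf (T k) = qpoch_inf * (fps_X ^ k * (invq k * invq k))" for k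
  proof -
    have "T k = (\<lambda>j. fps_X ^ k * invq k * ((- 1) ^ j * fps_X ^ ((j ^ 2 + j) div 2 + k * j) * invq j))"
      by (simp add: T_def power_add mult_ac fun_eq_iff)
    moreover have "null_tail (\<lambda>j. (- 1) ^ j * fps_X ^ ((j ^ 2 + j) div 2 + k * j) * invq j)"
      using null_tail_X_power[of "\<lambda>j. (j ^ 2 + j) div 2 + k * j" "\<lambda>j. (- 1) ^ j * invq j"]
        le_triangular by (simp add: mult_ac trans_le_add1)
    ultimately have "suminf (T k) = fps_X ^ k * invq k *
        suminf (\<lambda>j. (- 1) ^ j * fps_X ^ ((j ^ 2 + j) div 2 + k * j) * invq j)"
      by (simp only:) (rule suminf_fps_cmult)
    also have "\<dots> = fps_X ^ k * invq k *
        suminf (\<lambda>j. (- 1) ^ j * fps_X ^ ((j ^ 2 + j) div 2 + k * j) * invq j) * (qpoch k * invq k)"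
      by simp
    also have "\<dots> = fps_X ^ k * invq k * qpoch_inf * invq k"
      unfolding euler_sum[of k, symmetric] by (simp only: mult_ac)
    finally show ?thesis by (simp only: mult_ac)
  qed
  have cols: "suminf (\<lambda>k. T k j) = inverse qpoch_inf * t j" for j
  proof -
    have "(\<lambda>k. T k j) = (\<lambda>k. t j * invq j * (fps_X ^ (k * Suc j) * invq k))"
      by (simp add: T_def t_def power_add mult_ac fun_eq_iff)
    then have "suminf (\<lambda>k. T k j) = t j * invq j * suminf (\<lambda>k. fps_X ^ (k * Suc j) * invq k)"
      by (simp only:) (subst suminf_fps_cmult, rule null_tail_X_power, simp_all)
    also have "\<dots> = t j * invq j * (suminf (\<lambda>k. fps_X ^ (k * Suc j) * invq k) * qpoch_inf) * inverse qpoch_inf"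
      by (simp add: mult.assoc)
    also have "\<dots> = t j * (invq j * qpoch j) * inverse qpoch_inf"
      by (simp only: euler_sum_inverse mult.assoc)
    finally show ?thesis by (simp add: mult_ac)
  qed
  have "qpoch_inf * hook_series = suminf (\<lambda>k. suminf (T k))"
    unfolding rows by (rule suminf_fps_cmult[symmetric]) (rule null_tail_X_power, simp)
  also have "\<dots> = suminf (\<lambda>j. suminf (\<lambda>k. T k j))"
    by (rule suminf_fps_swap) (rule ntT)
  also have "\<dots> = inverse qpoch_inf * suminf t"
    unfolding cols by (rule suminf_fps_cmult) (rule ntt)
  finally have "qpoch_inf * hook_series = inverse qpoch_inf * suminf t" .
  then have "inverse qpoch_inf * (qpoch_inf * hook_series) =
      inverse qpoch_inf * (inverse qpoch_inf * suminf t)"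
    by simp
  then have "hook_series = inverse qpoch_inf * inverse qpoch_inf * suminf t"
    by (simp add: mult.assoc[symmetric])
  also have "inverse qpoch_inf * inverse qpoch_inf = 1 / qpoch_inf ^ 2"
    by (subst fps_divide_unit) (simp_all add: power2_eq_square fps_inverse_mult)
  finally show ?thesis
    by (simp add: t_def[abs_def])
qed

text \<open>The Durfee square identity (\<open>j = 0\<close>) expands \<open>1 / (q)\<^sub>n\<^sup>2\<close>; in the double sum over \<open>k \<le> n\<close>, the sum
  over \<open>n - k\<close> is \<open>\<Sum>\<^sub>m q\<^sup>m / (q)\<^sub>m = 1 / (q)\<^sub>\<infinity>\<close>.\<close>

lemma hook_series_eq_durfee:
  "hook_series =
    1 / qpoch_inf * suminf (\<lambda>k. fps_X ^ (k ^ 2 + k) / qpoch k ^ 2)"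
proof -
  define T where "T n k = (if k \<le> n then fps_X ^ (k * k + n) * (invq k * invq k * invq (n - k)) else 0)" for n k
  have ntT: "i < n \<or> i < k \<Longrightarrow> fps_nth (T n k) i = 0" for n k i
    by (auto simp: T_def fps_X_power_mult_nth)
  have rows: "suminf (T n) = fps_X ^ n * (invq n * invq n)" for n
  proof -
    have "suminf (T n) = (\<Sum>k\<le>n. T n k)"
      by (rule suminf_finite) (auto simp: T_def)
    also have "\<dots> = fps_X ^ n * (\<Sum>k\<le>n. fps_X ^ (k * (k + 0)) * invq k * invq (n - k) * invq (k + 0))"
      unfolding sum_distrib_left by (rule sum.cong) (simp_all add: T_def power_add mult_ac)
    finally show ?thesis
      unfolding durfee_rectangle by simp
  qed
  have e1: "suminf (\<lambda>m. fps_X ^ m * invq m) = inverse qpoch_inf"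
  proof -
    have "suminf (\<lambda>m. fps_X ^ m * invq m) * qpoch_inf * inverse qpoch_inf = inverse qpoch_inf"
      using euler_sum_inverse[of 0] by simp
    then show ?thesis
      by (simp add: mult.assoc)
  qed
  have shift: "suminf (\<lambda>n. T n k) = suminf (\<lambda>m. T (m + k) k)" for k
  proof (rule fps_ext)
    fix i
    have nt: "null_tail (\<lambda>n. T n k)" "null_tail (\<lambda>m. T (m + k) k)"
      using ntT by auto
    have "fps_nth (suminf (\<lambda>n. T n k)) i = (\<Sum>n\<le>i + k. fps_nth (T n k) i)"
      using nt(1) by (rule fps_nth_suminf_le) simp
    also have "\<dots> = (\<Sum>n=k..i + k. fps_nth (T n k) i)"
      by (rule sum.mono_neutral_right) (auto simp: T_def)
    also have "\<dots> = (\<Sum>m\<le>i. fps_nth (T (m + k) k) i)"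
      by (rule sum.reindex_bij_witness[of _ "\<lambda>m. m + k" "\<lambda>n. n - k"]) auto
    finally show "fps_nth (suminf (\<lambda>n. T n k)) i = fps_nth (suminf (\<lambda>m. T (m + k) k)) i"
      using fps_nth_suminf[OF nt(2)] by simp
  qed
  have div: "fps_X ^ (k ^ 2 + k) / qpoch k ^ 2 = fps_X ^ (k * k + k) * (invq k * invq k)" for k
    by (subst fps_divide_unit) (simp_all add: power2_eq_square fps_inverse_mult fps_mult_nth_0)
  have cols: "suminf (\<lambda>n. T n k) = inverse qpoch_inf * (fps_X ^ (k ^ 2 + k) / qpoch k ^ 2)" for k
  proof -
    have "(\<lambda>m. T (m + k) k) = (\<lambda>m. fps_X ^ (k * k + k) * (invq k * invq k) * (fps_X ^ m * invq m))"
      by (simp add: T_def power_add mult_ac fun_eq_iff)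
    then have "suminf (\<lambda>n. T n k) = fps_X ^ (k * k + k) * (invq k * invq k) * suminf (\<lambda>m. fps_X ^ m * invq m)"
      unfolding shift by (simp only:) (rule suminf_fps_cmult, rule null_tail_X_power, simp)
    then show ?thesis
      unfolding e1 div by (simp only: mult_ac)
  qed
  have "hook_series = suminf (\<lambda>n. suminf (T n))"
    by (simp only: rows)
  also have "\<dots> = suminf (\<lambda>k. suminf (\<lambda>n. T n k))"
    by (rule suminf_fps_swap) (rule ntT)
  also have "\<dots> = inverse qpoch_inf * suminf (\<lambda>k. fps_X ^ (k ^ 2 + k) / qpoch k ^ 2)"
    unfolding cols unfolding div by (rule suminf_fps_cmult) (rule null_tail_X_power, simp)
  also have "inverse qpoch_inf = 1 / qpoch_inf"
    by (subst fps_divide_unit) simp_all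
  finally show ?thesis .
qed

section \<open>Counting pairs of partitions\<close>

text \<open>The recursion either lowers \<open>k\<close> or removes \<open>k + 1\<close> from the weight. It holds for descending lists of
  length \<open>k\<close> as well as for multisets of numbers below \<open>k\<close>; these two families are related by
  conjugation of partitions.\<close>

lemma partition_count_series:
  fixes c :: "nat \<Rightarrow> nat \<Rightarrow> nat"
  assumes "\<And>n. c 0 n = (if n = 0 then 1 else 0)"
    and "\<And>k n. c (Suc k) n = c k n + (if Suc k \<le> n then c (Suc k) (n - Suc k) else 0)"
  shows "Abs_fps (\<lambda>n. of_nat (c k n)) = invq k"
proof (induction k)
  case 0
  show ?case
    by (rule fps_ext) (simp add: assms(1))
next
  case (Suc k)
  have "(1 - fps_X ^ Suc k) * Abs_fps (\<lambda>n. of_nat (c (Suc k) n)) = Abs_fps (\<lambda>n. of_nat (c k n) :: rat)"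
    by (rule fps_ext)
      (simp add: left_diff_distrib fps_X_power_mult_nth assms(2)[of k] del: power_Suc)
  also have "\<dots> = (1 - fps_X ^ Suc k) * invq (Suc k)"
    by (simp only: Suc invq_Suc)
  finally have eq: "(1 - fps_X ^ Suc k) * Abs_fps (\<lambda>n. of_nat (c (Suc k) n)) =
      (1 - fps_X ^ Suc k) * invq (Suc k)" .
  have "(1 - fps_X ^ Suc k :: rat fps) \<noteq> 0"
  proof
    assume "(1 - fps_X ^ Suc k :: rat fps) = 0"
    then have "fps_nth (1 - fps_X ^ Suc k :: rat fps) 0 = 0"
      by simp
    then show False
      by simp
  qed
  then show ?case
    using eq mult_left_cancel by blast
qed

definition descending_lists :: "nat \<Rightarrow> nat \<Rightarrow> nat list set" where
  "descending_lists k n = {xs. length xs = k \<and> sorted_wrt (\<ge>) xs \<and> sum_list xs = n}"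

definition multisets_below :: "nat \<Rightarrow> nat \<Rightarrow> nat multiset set" where
  "multisets_below k n = {M. (\<forall>r\<in>#M. r < k) \<and> (\<Sum>r\<in>#M. Suc r) = n}"

definition multisets_of_size :: "nat \<Rightarrow> nat \<Rightarrow> nat multiset set" where
  "multisets_of_size k n = {M. size M = k \<and> \<Sum>\<^sub># M = n}"

lemma finite_descending_lists: "finite (descending_lists k n)"
proof (rule finite_subset)
  show "descending_lists k n \<subseteq> {xs. set xs \<subseteq> {..n} \<and> length xs = k}"
    using member_le_sum_list by (fastforce simp: descending_lists_def)
qed (simp add: finite_lists_length_eq)

text \<open>Either the last entry is \<open>0\<close>, or all \<open>k + 1\<close> entries can be lowered by one.\<close>

lemma descending_lists_Suc:
  "descending_lists (Suc k) n = (\<lambda>xs. xs @ [0]) ` descending_lists k n \<union>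
    (if Suc k \<le> n then map Suc ` descending_lists (Suc k) (n - Suc k) else {})"
proof (intro equalityI subsetI)
  fix xs
  assume xs: "xs \<in> descending_lists (Suc k) n"
  then have "xs \<noteq> []"
    by (auto simp: descending_lists_def)
  then obtain ys y where ys: "xs = ys @ [y]"
    using rev_exhaust by blast
  show "xs \<in> (\<lambda>xs. xs @ [0]) ` descending_lists k n \<union>
    (if Suc k \<le> n then map Suc ` descending_lists (Suc k) (n - Suc k) else {})"
  proof (cases "y = 0")
    case True
    then have "ys \<in> descending_lists k n"
      using xs ys by (simp add: descending_lists_def sorted_wrt_append)
    then show ?thesis
      using ys True by blast
  next
    case False
    have "\<forall>x\<in>set xs. y \<le> x"
      using xs ys by (simp add: descending_lists_def sorted_wrt_append)
    then have pos: "x > 0" if "x \<in> set xs" for x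
      using that False by fastforce
    define zs where "zs = map (\<lambda>x. x - 1) xs"
    have zs: "xs = map Suc zs"
      using pos by (simp add: zs_def map_idI)
    have "sum_list (map Suc zs) = sum_list zs + length zs"
      by (induction zs) simp_all
    then have "Suc k \<le> n" "zs \<in> descending_lists (Suc k) (n - Suc k)"
      using xs by (auto simp: zs descending_lists_def sorted_wrt_map)
    then show ?thesis
      using zs by auto
  qed
next
  fix xs
  assume "xs \<in> (\<lambda>xs. xs @ [0]) ` descending_lists k n \<union>
    (if Suc k \<le> n then map Suc ` descending_lists (Suc k) (n - Suc k) else {})"
  moreover have "sum_list (map Suc zs) = sum_list zs + length zs" for zs
    by (induction zs) simp_all
  ultimately show "xs \<in> descending_lists (Suc k) n"
    by (auto simp: descending_lists_def sorted_wrt_append sorted_wrt_map split: if_splits)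
qed

lemma descending_lists_series: "Abs_fps (\<lambda>n. of_nat (card (descending_lists k n))) = invq k"
proof (rule partition_count_series)
  fix n
  have "descending_lists 0 n = (if n = 0 then {[]} else {})"
    by (auto simp: descending_lists_def)
  then show "card (descending_lists 0 n) = (if n = 0 then 1 else 0)"
    by simp
next
  fix k n
  have "(\<lambda>xs. xs @ [0]) ` descending_lists k n \<inter> map Suc ` descending_lists (Suc k) m = {}" for m
  proof -
    have "0 \<in> set xs" if "xs \<in> (\<lambda>xs. xs @ [0]) ` descending_lists k n" for xs
      using that by auto
    moreover have "0 \<notin> set xs" if "xs \<in> map Suc ` descending_lists (Suc k) m" for xs
      using that by auto
    ultimately show ?thesis
      by blast
  qed
  then show "card (descending_lists (Suc k) n) = card (descending_lists k n) +
      (if Suc k \<le> n then card (descending_lists (Suc k) (n - Suc k)) else 0)"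
    unfolding descending_lists_Suc[of k n]
    by (auto simp: card_Un_disjoint finite_descending_lists card_image inj_on_def)
qed

lemma bij_betw_mset_descending: "bij_betw mset (descending_lists k n) (multisets_of_size k n)"
proof (rule bij_betwI')
  fix xs ys
  assume "xs \<in> descending_lists k n" "ys \<in> descending_lists k n"
  then have "sorted (rev xs)" "sorted (rev ys)"
    by (simp_all add: descending_lists_def sorted_wrt_rev)
  then show "mset xs = mset ys \<longleftrightarrow> xs = ys"
    by (metis mset_rev properties_for_sort rev_rev_ident)
next
  fix xs
  assume "xs \<in> descending_lists k n"
  then show "mset xs \<in> multisets_of_size k n"
    by (simp add: descending_lists_def multisets_of_size_def sum_mset_sum_list)
next
  fix M
  assume M: "M \<in> multisets_of_size k n"
  define xs where "xs = rev (sorted_list_of_multiset M)"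
  have [simp]: "mset xs = M"
    by (simp add: xs_def)
  have "sorted_wrt (\<ge>) xs"
    by (simp add: xs_def sorted_wrt_rev)
  then have "xs \<in> descending_lists k n"
    using M \<open>mset xs = M\<close> size_mset[of xs] sum_mset_sum_list[of xs]
    by (simp add: descending_lists_def multisets_of_size_def)
  then show "\<exists>xs\<in>descending_lists k n. M = mset xs"
    using \<open>mset xs = M\<close> by blast
qed

lemma finite_multisets_of_size: "finite (multisets_of_size k n)"
  using bij_betw_finite[OF bij_betw_mset_descending] finite_descending_lists by blast

lemma multisets_of_size_series: "Abs_fps (\<lambda>n. of_nat (card (multisets_of_size k n))) = invq k"
  using descending_lists_series[of k] by (simp add: bij_betw_same_card[OF bij_betw_mset_descending])

text \<open>An element \<open>r\<close> counts for \<open>r + 1\<close>, so an occurrence of the largest admissible element \<open>k\<close>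
  contributes \<open>k + 1\<close> to the weight.\<close>

lemma multisets_below_Suc:
  "multisets_below (Suc k) n = multisets_below k n \<union>
    (if Suc k \<le> n then add_mset k ` multisets_below (Suc k) (n - Suc k) else {})"
proof (intro equalityI subsetI)
  fix M
  assume M: "M \<in> multisets_below (Suc k) n"
  show "M \<in> multisets_below k n \<union>
    (if Suc k \<le> n then add_mset k ` multisets_below (Suc k) (n - Suc k) else {})"
  proof (cases "k \<in># M")
    case True
    then obtain M' where "M = add_mset k M'"
      by (meson multi_member_split)
    then show ?thesis
      using M by (auto simp: multisets_below_def)
  next
    case False
    then show ?thesis
      using M by (auto simp: multisets_below_def less_Suc_eq)
  qed
next
  fix M
  assume "M \<in> multisets_below k n \<union>
    (if Suc k \<le> n then add_mset k ` multisets_below (Suc k) (n - Suc k) else {})"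
  then show "M \<in> multisets_below (Suc k) n"
    by (auto simp: multisets_below_def split: if_splits)
qed

lemma finite_multisets_below: "finite (multisets_below k n)"
proof (induction k arbitrary: n)
  case 0
  have "multisets_below 0 n \<subseteq> {{#}}"
    by (auto simp: multisets_below_def)
  then show ?case
    by (rule finite_subset) simp
next
  case (Suc k)
  show ?case
  proof (induction n rule: less_induct)
    case (less n)
    then show ?case
      unfolding multisets_below_Suc[of k n] using Suc by simp
  qed
qed

lemma multisets_below_series: "Abs_fps (\<lambda>n. of_nat (card (multisets_below k n))) = invq k"
proof (rule partition_count_series)
  fix n
  have "multisets_below 0 n = (if n = 0 then {{#}} else {})"
    by (auto simp: multisets_below_def)
  then show "card (multisets_below 0 n) = (if n = 0 then 1 else 0)"
    by simp
next
  fix k n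
  have "multisets_below k n \<inter> add_mset k ` multisets_below (Suc k) m = {}" for m
    by (auto simp: multisets_below_def)
  then show "card (multisets_below (Suc k) n) = card (multisets_below k n) +
      (if Suc k \<le> n then card (multisets_below (Suc k) (n - Suc k)) else 0)"
    unfolding multisets_below_Suc[of k n]
    by (auto simp: card_Un_disjoint finite_multisets_below card_image inj_on_def)
qed

text \<open>The shift by \<open>k\<close> in the weight comes from the \<open>k\<close> corner boxes of the hooks, respectively from the
  degree \<open>l + 1\<close> of the variable \<open>p\<^sub>l\<close>. The maps \<open>wt\<close> and \<open>sz\<close> serve to recover \<open>i\<close> and \<open>k\<close> from an
  element, so that the unions are disjoint.\<close>

lemma product_counts_series:
  fixes A B :: "nat \<Rightarrow> nat \<Rightarrow> _ set"
  assumes fin: "\<And>k n. finite (A k n)" "\<And>k n. finite (B k n)"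
    and ser: "\<And>k. Abs_fps (\<lambda>n. of_nat (card (A k n))) = invq k"
      "\<And>k. Abs_fps (\<lambda>n. of_nat (card (B k n))) = invq k"
    and disj: "\<And>k n a. a \<in> A k n \<Longrightarrow> wt a = n" "\<And>k n b. b \<in> B k n \<Longrightarrow> sz b = k"
    and S: "\<And>N. S N = (\<Union>k\<le>N. \<Union>i\<le>N - k. A k i \<times> B k (N - k - i))"
  shows "Abs_fps (\<lambda>N. of_nat (card (S N))) = hook_series"
proof (rule fps_ext)
  fix N
  have nt: "null_tail (\<lambda>k. fps_X ^ k * (invq k * invq k))"
    by (rule null_tail_X_power) simp
  have nth: "of_nat (card (A k n)) = fps_nth (invq k) n" "of_nat (card (B k n)) = fps_nth (invq k) n"
    for k n
    using arg_cong[OF ser(1)[of k], of "\<lambda>f. fps_nth f n"]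
      arg_cong[OF ser(2)[of k], of "\<lambda>f. fps_nth f n"] by (simp_all only: fps_nth_Abs_fps)
  have "card (S N) = (\<Sum>k\<le>N. card (\<Union>i\<le>N - k. A k i \<times> B k (N - k - i)))"
    unfolding S by (rule card_UN_disjoint) (use fin disj in \<open>auto, blast\<close>)
  also have "\<dots> = (\<Sum>k\<le>N. \<Sum>i\<le>N - k. card (A k i \<times> B k (N - k - i)))"
    by (intro sum.cong refl card_UN_disjoint) (use fin disj in \<open>auto, blast\<close>)
  finally have "of_nat (card (S N)) =
      (\<Sum>k\<le>N. \<Sum>i\<le>N - k. fps_nth (invq k) i * fps_nth (invq k) (N - k - i))"
    by (simp add: card_cartesian_product nth)
  also have "\<dots> = (\<Sum>k\<le>N. fps_nth (fps_X ^ k * (invq k * invq k)) N)"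
    by (intro sum.cong refl, subst fps_X_power_mult_nth) (simp add: fps_mult_nth atMost_atLeast0)
  also have "\<dots> = fps_nth (hook_series) N"
    by (rule fps_nth_suminf[OF nt, symmetric])
  finally show "fps_nth (Abs_fps (\<lambda>N. of_nat (card (S N)))) N =
      fps_nth (hook_series) N"
    by simp
qed

text \<open>A pair \<open>(R, L)\<close> stands for the monomial with variables \<open>x\<^sub>r\<close>, \<open>r \<in> R\<close>, and \<open>p\<^sub>l\<close>, \<open>l \<in> L\<close>. Its degree
  \<open>k\<close> in \<open>p\<close> bounds the indices of the \<open>x\<^sub>r\<close>.\<close>

definition standard_pairs :: "nat \<Rightarrow> (nat multiset \<times> nat multiset) set" where
  "standard_pairs N = {(R, L). (\<forall>r\<in>#R. r < size L) \<and> (\<Sum>r\<in>#R. Suc r) + (\<Sum>l\<in>#L. Suc l) = N}"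

lemma sum_mset_Suc: "(\<Sum>l\<in>#L. Suc l) = size L + \<Sum>\<^sub># L"
  by (induction L) simp_all

lemma standard_pairs_eq:
  "standard_pairs N = (\<Union>k\<le>N. \<Union>i\<le>N - k. multisets_below k i \<times> multisets_of_size k (N - k - i))"
  by (auto simp: standard_pairs_def multisets_below_def multisets_of_size_def sum_mset_Suc)

lemma finite_standard_pairs: "finite (standard_pairs N)"
  unfolding standard_pairs_eq by (simp add: finite_multisets_below finite_multisets_of_size)

lemma standard_pairs_series:
  "Abs_fps (\<lambda>N. of_nat (card (standard_pairs N))) = hook_series"
  by (rule product_counts_series[where wt = "\<lambda>M. \<Sum>r\<in>#M. Suc r" and sz = size, OF finite_multisets_below
        finite_multisets_of_size multisets_below_series multisets_of_size_series _ _ standard_pairs_eq])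
    (simp_all add: multisets_below_def multisets_of_size_def)

section \<open>Plane partitions over the hook\<close>

definition hook :: "nat \<Rightarrow> nat \<Rightarrow> (nat \<times> nat) set" where
  "hook a b = young_diagram (Suc a # replicate b 1)"

lemma hook_eq: "hook a b = (\<lambda>j. (1, j)) ` {1..Suc a} \<union> (\<lambda>i. (i, 1)) ` {2..Suc b}"
proof -
  have "(i, j) \<in> hook a b \<longleftrightarrow> (i, j) \<in> (\<lambda>j. (1, j)) ` {1..Suc a} \<union> (\<lambda>i. (i, 1)) ` {2..Suc b}" for i j
  proof (cases i)
    case (Suc i')
    then show ?thesis
      by (cases i') (auto simp: hook_def young_diagram_def image_iff)
  qed (auto simp: hook_def young_diagram_def)
  then show ?thesis
    by auto
qed

lemma card_hook: "card (hook a b) = Suc (a + b)"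
  unfolding hook_eq by (subst card_Un_disjoint) (auto simp: card_image inj_on_def)

lemma hook_subset_iff: "hook a b \<subseteq> hook c d \<longleftrightarrow> a \<le> c \<and> b \<le> d"
proof
  assume sub: "hook a b \<subseteq> hook c d"
  have "(1, Suc a) \<in> hook a b"
    by (simp add: hook_eq)
  then have "(1, Suc a) \<in> hook c d"
    using sub by blast
  then have "a \<le> c"
    by (auto simp: hook_eq)
  moreover have "b \<le> d"
  proof (cases b)
    case (Suc b')
    then have "(Suc b, 1) \<in> hook a b"
      by (simp add: hook_eq)
    then have "(Suc b, 1) \<in> hook c d"
      using sub by blast
    then show ?thesis
      using Suc by (auto simp: hook_eq)
  qed simp
  ultimately show "a \<le> c \<and> b \<le> d" ..
qed (auto simp: hook_eq)

lemma hook_eq_iff: "hook a b = hook c d \<longleftrightarrow> a = c \<and> b = d"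
  by (metis hook_subset_iff order_antisym order_refl)

lemma hook_diagram_iff: "hook_diagram D \<longleftrightarrow> (\<exists>a b. D = hook a b)"
  unfolding hook_diagram_def hook_def by (metis Suc_le_D One_nat_def le_SucI le0 Suc_le_mono)

text \<open>Nested hooks are recorded by the two descending lists of their arm and leg lengths, and the
  number of boxes of a hook is \<open>arm + leg + 1\<close>.\<close>

lemma plane_partition_series_eq:
  "plane_partition_series = hook_series"
proof -
  define S where "S N = (\<Union>k\<le>N. \<Union>i\<le>N - k. descending_lists k i \<times> descending_lists k (N - k - i))"
    for N :: nat
  define h where "h = (\<lambda>(as, bs). map2 hook as bs)"
  have len: "length as = length bs" if "(as, bs) \<in> S N" for as bs N
    using that by (auto simp: S_def descending_lists_def)
  have cubes: "num_cubes (map2 hook as bs) = length as + sum_list as + sum_list bs"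
    if "length as = length bs" for as bs
    using that by (induction as bs rule: list_induct2) (auto simp: num_cubes_def card_hook)
  have "bij_betw h (S N) {Ds. hook_plane_partition Ds \<and> num_cubes Ds = N}" for N
  proof (rule bij_betwI')
    fix x y
    assume "x \<in> S N" "y \<in> S N"
    moreover obtain as bs cs ds where xy: "x = (as, bs)" "y = (cs, ds)"
      by (metis prod.exhaust)
    ultimately have l: "length as = length bs" "length cs = length ds"
      using len by auto
    have "as = cs \<and> bs = ds" if eq: "map2 hook as bs = map2 hook cs ds"
    proof -
      have l': "length as = length cs"
        using arg_cong[OF eq, of length] l by simp
      have "as ! i = cs ! i \<and> bs ! i = ds ! i" if "i < length as" for i
        using arg_cong[OF eq, of "\<lambda>l. l ! i"] that l l' by (simp add: hook_eq_iff)
      then show ?thesis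
        using l l' by (auto intro: nth_equalityI)
    qed
    then show "h x = h y \<longleftrightarrow> x = y"
      by (auto simp: h_def xy)
  next
    fix x
    assume x: "x \<in> S N"
    obtain as bs where xe: "x = (as, bs)"
      by (metis prod.exhaust)
    have l: "length as = length bs"
      using x xe len by auto
    have s: "sorted_wrt (\<ge>) as" "sorted_wrt (\<ge>) bs" "length as + sum_list as + sum_list bs = N"
      using x xe by (auto simp: S_def descending_lists_def)
    have "sorted_wrt (\<lambda>D E. D \<supseteq> E) (map2 hook as bs)"
      using s(1,2) l by (auto simp: sorted_wrt_iff_nth_less hook_subset_iff)
    moreover have "\<forall>D\<in>set (map2 hook as bs). hook_diagram D"
      by (auto simp: hook_diagram_iff)
    ultimately show "h x \<in> {Ds. hook_plane_partition Ds \<and> num_cubes Ds = N}"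
      using cubes[OF l] s(3) by (simp add: h_def xe hook_plane_partition_def)
  next
    fix Ds
    assume "Ds \<in> {Ds. hook_plane_partition Ds \<and> num_cubes Ds = N}"
    then have Ds: "\<forall>D\<in>set Ds. hook_diagram D" "sorted_wrt (\<lambda>D E. D \<supseteq> E) Ds" "num_cubes Ds = N"
      by (simp_all add: hook_plane_partition_def)
    define arm where "arm = (\<lambda>D. SOME a. \<exists>b. D = hook a b)"
    define leg where "leg = (\<lambda>D. SOME b. D = hook (arm D) b)"
    have al: "D = hook (arm D) (leg D)" if "hook_diagram D" for D
    proof -
      have "\<exists>b. D = hook (arm D) b"
        unfolding arm_def using that[unfolded hook_diagram_iff] by (rule someI_ex)
      then show ?thesis
        unfolding leg_def by (rule someI_ex)
    qed
    define as bs where "as = map arm Ds" and "bs = map leg Ds"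
    have l: "length as = length bs"
      by (simp add: as_def bs_def)
    have eq: "Ds = map2 hook as bs"
      using Ds(1) by (intro nth_equalityI) (simp_all add: as_def bs_def al[symmetric])
    have "as ! i \<ge> as ! j \<and> bs ! i \<ge> bs ! j" if "i < j" "j < length as" for i j
    proof -
      have "hook (as ! j) (bs ! j) \<subseteq> hook (as ! i) (bs ! i)"
        using Ds(2) that l unfolding eq by (simp add: sorted_wrt_iff_nth_less)
      then show ?thesis
        by (simp add: hook_subset_iff)
    qed
    then have "sorted_wrt (\<ge>) as" "sorted_wrt (\<ge>) bs"
      using l by (auto simp: sorted_wrt_iff_nth_less)
    moreover have "length as + sum_list as + sum_list bs = N"
      using cubes[OF l] Ds(3) unfolding eq by simp
    ultimately have "as \<in> descending_lists (length as) (sum_list as)"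
      "bs \<in> descending_lists (length as) (N - length as - sum_list as)" "length as \<le> N"
      "sum_list as \<le> N - length as"
      using l by (auto simp: descending_lists_def)
    then have "(as, bs) \<in> S N"
      unfolding S_def by blast
    then show "\<exists>x\<in>S N. Ds = h x"
      using eq by (intro bexI[of _ "(as, bs)"]) (simp add: h_def)
  qed
  then have "card (S N) = card {Ds. hook_plane_partition Ds \<and> num_cubes Ds = N}" for N
    by (rule bij_betw_same_card)
  then have "plane_partition_series = Abs_fps (\<lambda>N. of_nat (card (S N)))"
    by (simp add: plane_partition_series_def)
  also have "\<dots> = hook_series"
    by (rule product_counts_series[where wt = sum_list and sz = length, OF finite_descending_lists
          finite_descending_lists descending_lists_series descending_lists_series _ _ S_def])
      (simp_all add: descending_lists_def)
  finally show ?thesis .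
qed

section \<open>Polynomials and substitutions\<close>

interpretation mp: vector_space "mscale :: complex \<Rightarrow> 'v mpoly \<Rightarrow> 'v mpoly"
  by (rule vector_space_mscale)

abbreviation lookup where "lookup \<equiv> Poly_Mapping.lookup"
abbreviation keys where "keys \<equiv> Poly_Mapping.keys"
abbreviation single where "single \<equiv> Poly_Mapping.single"

lemma mconst_simps [simp]: "mconst 0 = 0" "mconst 1 = 1"
  by (simp_all add: mconst_def)

lemma mconst_add: "mconst (a + b) = mconst a + mconst b"
  and mconst_mult: "mconst (a * b) = mconst a * mconst b"
  and mconst_uminus: "mconst (- a) = - mconst a"
  by (simp_all add: mconst_def single_add mult_single single_uminus)

lemma lookup_mscale [simp]: "lookup (mscale c p) m = c * lookup p m"
  unfolding mscale_def mconst_def mult_map_scale_conv_mult[symmetric]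
  by (simp add: Poly_Mapping.map.rep_eq when_def)

lemma mscale_mult_left: "mscale c p * q = mscale c (p * q)"
  and mscale_mult_right: "p * mscale c q = mscale c (p * q)"
  by (simp_all add: mscale_def mult_ac)

lemma poly_mapping_sum_singles:
  fixes p :: "'v \<Rightarrow>\<^sub>0 'c::comm_monoid_add"
  shows
  "p = (\<Sum>m\<in>keys p. single m (lookup p m))"
proof (rule poly_mapping_eqI)
  fix n
  have "lookup (\<Sum>m\<in>keys p. single m (lookup p m)) n = (\<Sum>m\<in>keys p. if m = n then lookup p n else 0)"
    by (simp add: lookup_sum lookup_single when_def if_distrib cong: if_cong)
  also have "\<dots> = lookup p n"
    by (simp add: sum.delta in_keys_iff)
  finally show "lookup p n = lookup (\<Sum>m\<in>keys p. single m (lookup p m)) n"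
    by simp
qed

lemma poly_mapping_single_induct [case_names single add]:
  fixes p :: "'v \<Rightarrow>\<^sub>0 'c::comm_monoid_add"
  assumes "\<And>m c. P (single m c)" "\<And>p q. P p \<Longrightarrow> P q \<Longrightarrow> P (p + q)"
  shows "P p"
proof -
  have *: "P (\<Sum>m\<in>S. single m (lookup p m))" if "finite S" for S
    using that
  proof (induction S rule: finite_induct)
    case empty
    have "P (single undefined 0)"
      by (rule assms(1))
    then show ?case by simp
  qed (simp add: assms)
  show ?thesis
    by (subst poly_mapping_sum_singles) (simp add: *)
qed

lemma single_sum_one: "single (sum f S) (1::complex) = (\<Prod>x\<in>S. single (f x) 1)"
proof (induction S rule: infinite_finite_induct)
  case (insert x S)
  then show ?case
    by (simp flip: insert.IH add: mult_single)
qed simp_all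

lemma single_single_power: "single (single x n) 1 = mvar x ^ n"
proof (induction n)
  case (Suc n)
  have "single (single x (Suc n)) 1 = mvar x * single (single x n) (1::complex)"
    by (simp add: mvar_def mult_single flip: single_add)
  then show ?case
    by (simp add: Suc)
qed simp

lemma single_eq_prod_vars: "single m c = mconst c * (\<Prod>x\<in>keys m. mvar x ^ lookup m x)"
proof -
  have "single m c = mconst c * single m 1"
    by (simp add: mconst_def mult_single)
  also have "single m (1::complex) = single (\<Sum>x\<in>keys m. single x (lookup m x)) 1"
    by (simp flip: poly_mapping_sum_singles)
  finally show ?thesis
    by (simp add: single_sum_one single_single_power)
qed

lemma mpoly_induct [case_names const var add mult]:
  assumes const: "\<And>c. P (mconst c)" and var: "\<And>x. P (mvar x)"
    and add: "\<And>p q. P p \<Longrightarrow> P q \<Longrightarrow> P (p + q)" and mult: "\<And>p q. P p \<Longrightarrow> P q \<Longrightarrow> P (p * q)"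
  shows "P p"
proof (induction p rule: poly_mapping_single_induct)
  case (single m c)
  have one: "P 1"
    using const[of 1] by simp
  have pow: "P (mvar x ^ n)" for x n
    by (induction n) (auto intro: one var mult)
  have "P (\<Prod>x\<in>S. mvar x ^ lookup m x)" for S
    by (induction S rule: infinite_finite_induct) (auto intro: one pow mult)
  then show ?case
    unfolding single_eq_prod_vars by (intro mult const)
qed (rule add)

text \<open>Substitutions are used with values in polynomials, in power series and in univariate polynomials
  (also iterated). The locale collects what makes \<open>msubst\<close> a ring homomorphism in
  all these cases.\<close>

locale structure_map =
  fixes \<iota> :: "complex \<Rightarrow> 'r::comm_ring_1"
  assumes \<iota>_1: "\<iota> 1 = 1" and \<iota>_add: "\<iota> (a + b) = \<iota> a + \<iota> b" and \<iota>_mult: "\<iota> (a * b) = \<iota> a * \<iota> b"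
begin

lemma \<iota>_0: "\<iota> 0 = 0"
  using \<iota>_add[of 0 0] by simp

definition eval_monom :: "('v \<Rightarrow> 'r) \<Rightarrow> ('v \<Rightarrow>\<^sub>0 nat) \<Rightarrow> 'r" where
  "eval_monom f m = (\<Prod>x\<in>keys m. f x ^ lookup m x)"

lemma eval_monom_superset:
  "finite S \<Longrightarrow> keys m \<subseteq> S \<Longrightarrow> eval_monom f m = (\<Prod>x\<in>S. f x ^ lookup m x)"
  unfolding eval_monom_def by (rule prod.mono_neutral_left) (auto simp: in_keys_iff)

lemma eval_monom_add: "eval_monom f (m + n) = eval_monom f m * eval_monom f n"
proof -
  have "keys (m + n) \<subseteq> keys m \<union> keys n"
    by (rule keys_add)
  then show ?thesis
    by (simp add: eval_monom_superset[of "keys m \<union> keys n"] lookup_add power_add prod.distrib)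
qed

lemma msubst_superset:
  "finite S \<Longrightarrow> keys P \<subseteq> S \<Longrightarrow> msubst \<iota> f P = (\<Sum>m\<in>S. \<iota> (lookup P m) * eval_monom f m)"
  unfolding msubst_def eval_monom_def
  by (rule sum.mono_neutral_left) (auto simp: in_keys_iff \<iota>_0)

lemma msubst_add: "msubst \<iota> f (P + Q) = msubst \<iota> f P + msubst \<iota> f Q"
proof -
  have "keys (P + Q) \<subseteq> keys P \<union> keys Q"
    by (rule keys_add)
  then show ?thesis
    by (simp add: msubst_superset[of "keys P \<union> keys Q"] lookup_add \<iota>_add distrib_right sum.distrib)
qed

lemma msubst_single: "msubst \<iota> f (single m c) = \<iota> c * eval_monom f m"
  by (subst msubst_superset[of "{m}"]) auto

lemma msubst_mult: "msubst \<iota> f (P * Q) = msubst \<iota> f P * msubst \<iota> f Q"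
proof (induction P rule: poly_mapping_single_induct)
  case (single m c)
  show ?case
  proof (induction Q rule: poly_mapping_single_induct)
    case (single n d)
    show ?case
      by (simp add: mult_single msubst_single eval_monom_add \<iota>_mult mult_ac)
  qed (simp add: distrib_left msubst_add)
qed (simp add: distrib_right msubst_add)

lemma msubst_mconst: "msubst \<iota> f (mconst c) = \<iota> c"
  by (simp add: mconst_def msubst_single eval_monom_def)

lemma msubst_mvar: "msubst \<iota> f (mvar x) = f x"
  by (simp add: mvar_def msubst_single eval_monom_def \<iota>_1)

lemmas msubst_simps = msubst_add msubst_mult msubst_mconst msubst_mvar

lemma msubst_0: "msubst \<iota> f 0 = 0" and msubst_1: "msubst \<iota> f 1 = 1"
  using msubst_mconst[of f 0] msubst_mconst[of f 1] by (simp_all add: \<iota>_0 \<iota>_1)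

lemma msubst_uminus: "msubst \<iota> f (- P) = - msubst \<iota> f P"
  using msubst_add[of f P "- P"] by (simp add: msubst_0 add_eq_0_iff)

lemma msubst_diff: "msubst \<iota> f (P - Q) = msubst \<iota> f P - msubst \<iota> f Q"
  using msubst_add[of f P "- Q"] by (simp add: msubst_uminus)

lemma msubst_mscale: "msubst \<iota> f (mscale c P) = \<iota> c * msubst \<iota> f P"
  by (simp add: mscale_def msubst_simps)

lemma msubst_sum: "msubst \<iota> f (\<Sum>i\<in>S. P i) = (\<Sum>i\<in>S. msubst \<iota> f (P i))"
  by (induction S rule: infinite_finite_induct) (simp_all add: msubst_0 msubst_add)

lemma msubst_power: "msubst \<iota> f (P ^ n) = msubst \<iota> f P ^ n"
  by (induction n) (simp_all add: msubst_1 msubst_mult)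

definition msubst_fps :: "('v \<Rightarrow> 'r) \<Rightarrow> 'v mpoly fps \<Rightarrow> 'r fps" where
  "msubst_fps f F = Abs_fps (\<lambda>n. msubst \<iota> f (fps_nth F n))"

lemma msubst_fps_nth [simp]: "fps_nth (msubst_fps f F) n = msubst \<iota> f (fps_nth F n)"
  by (simp add: msubst_fps_def)

lemma msubst_fps_add: "msubst_fps f (F + G) = msubst_fps f F + msubst_fps f G"
  by (rule fps_ext) (simp add: msubst_add)

lemma msubst_fps_mult: "msubst_fps f (F * G) = msubst_fps f F * msubst_fps f G"
  by (rule fps_ext) (simp add: fps_mult_nth msubst_sum msubst_mult)

lemma msubst_fps_power: "msubst_fps f (F ^ n) = msubst_fps f F ^ n"
proof (induction n)
  case 0
  show ?case
    by (rule fps_ext) (simp add: msubst_1 msubst_0)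
qed (simp add: msubst_fps_mult)

end

interpretation mconst: structure_map "mconst :: complex \<Rightarrow> 'v mpoly"
  by unfold_locales (simp_all add: mconst_add mconst_mult)

interpretation fps_mconst: structure_map "\<lambda>a. fps_const (mconst a :: 'v mpoly)"
  by unfold_locales (simp_all add: mconst_add mconst_mult)

interpretation poly_const: structure_map "\<lambda>a::complex. [:a:]"
  by unfold_locales (simp_all add: one_pCons)

interpretation poly_mconst: structure_map "\<lambda>a. [:mconst a :: 'v mpoly:]"
  by unfold_locales (simp_all add: mconst_add mconst_mult one_pCons)

interpretation poly_poly_mconst: structure_map "\<lambda>a. [:[:mconst a :: 'v mpoly:]:]"
  by unfold_locales (simp_all add: mconst_add mconst_mult one_pCons)

section \<open>Homogeneous polynomials\<close>

lemma wdegree_superset: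
  "finite S \<Longrightarrow> keys m \<subseteq> S \<Longrightarrow> wdegree w m = (\<Sum>x\<in>S. lookup m x * w x)"
  unfolding wdegree_def by (rule sum.mono_neutral_left) (auto simp: in_keys_iff)

lemma wdegree_add: "wdegree w (m + n) = wdegree w m + wdegree w n"
proof -
  have "keys (m + n) \<subseteq> keys m \<union> keys n"
    by (rule keys_add)
  then show ?thesis
    by (simp add: wdegree_superset[of "keys m \<union> keys n"] lookup_add distrib_right sum.distrib)
qed

lemma wdegree_0 [simp]: "wdegree w 0 = 0"
  by (simp add: wdegree_def)

lemma wdegree_single [simp]: "wdegree w (single x n) = n * w x"
  by (cases "n = 0") (simp_all add: wdegree_def)

lemma homogeneousD: "homogeneous w N p \<Longrightarrow> lookup p m \<noteq> 0 \<Longrightarrow> wdegree w m = N"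
  by (auto simp: homogeneous_def in_keys_iff)

lemma homogeneousI: "(\<And>m. lookup p m \<noteq> 0 \<Longrightarrow> wdegree w m = N) \<Longrightarrow> homogeneous w N p"
  by (auto simp: homogeneous_def in_keys_iff)

lemma homogeneous_0 [simp]: "homogeneous w N 0"
  by (simp add: homogeneous_def)

lemma homogeneous_add: "homogeneous w N p \<Longrightarrow> homogeneous w N q \<Longrightarrow> homogeneous w N (p + q)"
  using keys_add[of p q] unfolding homogeneous_def by blast

lemma homogeneous_mscale: "homogeneous w N p \<Longrightarrow> homogeneous w N (mscale c p)"
  by (rule homogeneousI) (auto dest: homogeneousD)

lemma subspace_homogeneous: "mp.subspace {p. homogeneous w N p}"
  by (rule mp.subspaceI) (simp_all add: homogeneous_add homogeneous_mscale)

lemma homogeneous_diff: "homogeneous w N p \<Longrightarrow> homogeneous w N q \<Longrightarrow> homogeneous w N (p - q)"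
  using mp.subspace_diff[OF subspace_homogeneous] by blast

lemma homogeneous_sum: "(\<And>i. i \<in> S \<Longrightarrow> homogeneous w N (p i)) \<Longrightarrow> homogeneous w N (\<Sum>i\<in>S. p i)"
  using mp.subspace_sum[OF subspace_homogeneous, of S p w N] by blast

lemma homogeneous_mult: "homogeneous w M p \<Longrightarrow> homogeneous w N q \<Longrightarrow> homogeneous w (M + N) (p * q)"
  using keys_mult[of p q] unfolding homogeneous_def by (fastforce simp: wdegree_add)

lemma homogeneous_mvar: "homogeneous w (w x) (mvar x)"
  by (simp add: homogeneous_def mvar_def)

lemma homogeneous_mconst: "homogeneous w 0 (mconst c)"
  by (rule homogeneousI) (auto simp: mconst_def lookup_single when_def split: if_splits)

lemma homogeneous_1: "homogeneous w 0 1"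
  using homogeneous_mconst[of w 1] by simp

lemma homogeneous_msubst:
  assumes "\<And>x. homogeneous w' (w x) (f x)" "homogeneous w N p"
  shows "homogeneous w' N (msubst mconst f p)"
proof -
  have pow: "homogeneous w' (n * w x) (f x ^ n)" for x n
    by (induction n) (simp_all add: homogeneous_1 assms(1) homogeneous_mult)
  have "homogeneous w' (\<Sum>x\<in>S. lookup m x * w x) (\<Prod>x\<in>S. f x ^ lookup m x)" for S m
    by (induction S rule: infinite_finite_induct) (simp_all add: homogeneous_1 pow homogeneous_mult)
  then have *: "homogeneous w' (wdegree w m) (mscale c (\<Prod>x\<in>keys m. f x ^ lookup m x))" for m c
    by (intro homogeneous_mscale) (simp add: wdegree_def)
  have "homogeneous w' N (mscale (lookup p m) (\<Prod>x\<in>keys m. f x ^ lookup m x))" if "m \<in> keys p" for m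
  proof -
    have "wdegree w m = N"
      using that assms(2) by (simp add: homogeneous_def)
    then show ?thesis
      using *[of m "lookup p m"] by simp
  qed
  then show ?thesis
    unfolding msubst_def mscale_def[symmetric] by (rule homogeneous_sum)
qed

text \<open>The factor \<open>e\<close> is \<open>1\<close> for the grading in which the variables of index \<open>r\<close> have degree \<open>r + 1\<close>, and \<open>0\<close>
  for gradings that ignore the index.\<close>

lemma homogeneous_fps_mult:
  assumes "\<And>n. homogeneous w (e * n + c) (fps_nth F n)" "\<And>n. homogeneous w (e * n + d) (fps_nth G n)"
  shows "homogeneous w (e * n + (c + d)) (fps_nth (F * G) n)"
  unfolding fps_mult_nth
proof (rule homogeneous_sum)
  fix i assume "i \<in> {0..n}"
  then have "e * i + e * (n - i) = e * n"
    by (simp flip: distrib_left)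
  then have "e * n + (c + d) = (e * i + c) + (e * (n - i) + d)"
    by linarith
  then show "homogeneous w (e * n + (c + d)) (fps_nth F i * fps_nth G (n - i))"
    using homogeneous_mult[OF assms(1)[of i] assms(2)[of "n - i"]] by metis
qed

lemma homogeneous_fps_power:
  assumes "\<And>n. homogeneous w (e * n + c) (fps_nth F n)"
  shows "homogeneous w (e * n + k * c) (fps_nth (F ^ k) n)"
proof (induction k arbitrary: n)
  case (Suc k)
  then show ?case
    using homogeneous_fps_mult[of w e c F "k * c" "F ^ k", OF assms] by simp
qed (simp add: homogeneous_1)

section \<open>Partial derivatives\<close>

lift_definition pdiff :: "'v \<Rightarrow> 'v mpoly \<Rightarrow> 'v mpoly" is
  "\<lambda>y p m. of_nat (Suc (lookup m y)) * p (m + single y 1)"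
proof -
  fix y :: 'v and p :: "('v \<Rightarrow>\<^sub>0 nat) \<Rightarrow> complex"
  assume "finite {m. p m \<noteq> 0}"
  moreover have "inj (\<lambda>m. m + single y (1::nat))"
    by (rule injI) simp
  ultimately have "finite ((\<lambda>m. m + single y 1) -` {m. p m \<noteq> 0})"
    by (rule finite_vimageI)
  then show "finite {m. of_nat (Suc (lookup m y)) * p (m + single y 1) \<noteq> 0}"
    by (rule rev_finite_subset) auto
qed

lemma lookup_pdiff: "lookup (pdiff y p) m = of_nat (Suc (lookup m y)) * lookup p (m + single y 1)"
  by (simp add: pdiff.rep_eq)

lemma pdiff_add: "pdiff y (p + q) = pdiff y p + pdiff y q"
  by (rule poly_mapping_eqI) (simp add: lookup_pdiff lookup_add distrib_left)

lemma pdiff_mscale: "pdiff y (mscale c p) = mscale c (pdiff y p)"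
  by (rule poly_mapping_eqI) (simp add: lookup_pdiff)

lemma pdiff_0 [simp]: "pdiff y 0 = 0"
  by (rule poly_mapping_eqI) (simp add: lookup_pdiff)

lemma pdiff_sum: "pdiff y (\<Sum>i\<in>S. p i) = (\<Sum>i\<in>S. pdiff y (p i))"
  by (induction S rule: infinite_finite_induct) (simp_all add: pdiff_add)

lemma add_single_minus: "lookup m y \<noteq> 0 \<Longrightarrow> m - single y (1::nat) + single y 1 = m"
  by (rule poly_mapping_eqI) (auto simp: lookup_add lookup_minus lookup_single when_def)

lemma pdiff_single: "pdiff y (single m c) = single (m - single y 1) (of_nat (lookup m y) * c)"
proof (rule poly_mapping_eqI)
  fix n
  show "lookup (pdiff y (single m c)) n = lookup (single (m - single y 1) (of_nat (lookup m y) * c)) n"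
  proof (cases "m = n + single y 1")
    case True
    then show ?thesis
      by (simp add: lookup_pdiff lookup_add)
  next
    case False
    then have "lookup m y = 0 \<or> m - single y 1 \<noteq> n"
      using add_single_minus[of m y] by auto
    then show ?thesis
      using False by (auto simp: lookup_pdiff lookup_single)
  qed
qed

lemma pdiff_mconst [simp]: "pdiff y (mconst c) = 0"
  by (simp add: mconst_def pdiff_single)

lemma pdiff_mvar: "pdiff y (mvar x) = (if x = y then 1 else 0)"
  by (auto simp: mvar_def pdiff_single lookup_single)

lemma pdiff_mult: "pdiff y (p * q) = pdiff y p * q + p * pdiff y q"
proof (induction p rule: poly_mapping_single_induct)
  case (single m c)
  show ?case
  proof (induction q rule: poly_mapping_single_induct)
    case (single n d)
    have 1: "single (m + n - single y 1) (of_nat (lookup m y) * (c * d)) =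
        single (m - single y 1 + n) (of_nat (lookup m y) * (c * d))"
    proof (cases "lookup m y = 0")
      case False
      have "m + n - single y 1 = m - single y 1 + n"
        using False by (intro poly_mapping_eqI)
          (auto simp: lookup_add lookup_minus lookup_single when_def)
      then show ?thesis by simp
    qed simp
    have 2: "single (m + n - single y 1) (of_nat (lookup n y) * (c * d)) =
        single (m + (n - single y 1)) (of_nat (lookup n y) * (c * d))"
    proof (cases "lookup n y = 0")
      case False
      have "m + n - single y 1 = m + (n - single y 1)"
        using False by (intro poly_mapping_eqI)
          (auto simp: lookup_add lookup_minus lookup_single when_def)
      then show ?thesis by simp
    qed simp
    have "pdiff y (single m c * single n d) =
        single (m + n - single y 1) (of_nat (lookup m y) * (c * d)) +
        single (m + n - single y 1) (of_nat (lookup n y) * (c * d))"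
      by (simp add: mult_single pdiff_single lookup_add distrib_right flip: single_add)
    then show ?case
      unfolding 1 2 by (simp add: mult_single pdiff_single mult.assoc mult.left_commute[of c])
  qed (simp add: distrib_left pdiff_add)
qed (simp add: distrib_right pdiff_add)

text \<open>The chain rule: the substitution \<open>x \<mapsto> a x + \<delta> b x\<close> changes a polynomial, to first order in \<open>\<delta>\<close>, by
  the sum of \<open>b y\<close> times the substituted partial derivative. As \<open>b\<close> may have infinite support, the
  sum ranges over any sufficiently large finite set of variables.\<close>

lemma msubst_first_order:
  fixes a b :: "'v \<Rightarrow> 'v mpoly poly"
  defines "\<Gamma> \<equiv> msubst (\<lambda>c. [:[:mconst c:]:]) (\<lambda>x. [:a x, b x:])"
    and "\<theta> \<equiv> msubst (\<lambda>c. [:mconst c:]) a"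
  shows "\<exists>Y. finite Y \<and> (\<forall>Y'. finite Y' \<longrightarrow> Y \<subseteq> Y' \<longrightarrow> coeff (\<Gamma> p) 1 = (\<Sum>y\<in>Y'. b y * \<theta> (pdiff y p)))"
proof -
  have \<Gamma>: "\<Gamma> (p + q) = \<Gamma> p + \<Gamma> q" "\<Gamma> (p * q) = \<Gamma> p * \<Gamma> q" "\<Gamma> (mconst c) = [:[:mconst c:]:]"
    "\<Gamma> (mvar x) = [:a x, b x:]" for p q c x
    by (simp_all add: \<Gamma>_def poly_poly_mconst.msubst_simps)
  have \<theta>: "\<theta> (p + q) = \<theta> p + \<theta> q" "\<theta> (p * q) = \<theta> p * \<theta> q" "\<theta> (mconst c) = [:mconst c:]"
    "\<theta> (mvar x) = a x" "\<theta> 0 = 0" "\<theta> 1 = 1" for p q c x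
    by (simp_all add: \<theta>_def poly_mconst.msubst_simps poly_mconst.msubst_0 poly_mconst.msubst_1)
  have c0: "coeff (\<Gamma> p) 0 = \<theta> p" for p
    by (induction p rule: mpoly_induct) (simp_all add: \<Gamma> \<theta> coeff_mult)
  show "\<exists>Y. finite Y \<and> (\<forall>Y'. finite Y' \<longrightarrow> Y \<subseteq> Y' \<longrightarrow> coeff (\<Gamma> p) 1 = (\<Sum>y\<in>Y'. b y * \<theta> (pdiff y p)))"
  proof (induction p rule: mpoly_induct)
    case (const c)
    then show ?case
      by (intro exI[of _ "{}"]) (simp add: \<Gamma> \<theta>)
  next
    case (var x)
    have "(\<Sum>y\<in>Y'. b y * \<theta> (pdiff y (mvar x))) = b x" if "finite Y'" "{x} \<subseteq> Y'" for Y'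
    proof -
      have "(\<Sum>y\<in>Y'. b y * \<theta> (pdiff y (mvar x))) = (\<Sum>y\<in>Y'. if x = y then b y else 0)"
        by (rule sum.cong) (simp_all add: pdiff_mvar \<theta>)
      then show ?thesis
        using that by (simp add: sum.delta')
    qed
    then show ?case
      by (intro exI[of _ "{x}"]) (simp add: \<Gamma>)
  next
    case (add p q)
    then obtain Y Z where YZ: "finite Y" "finite Z"
      "\<And>Y'. finite Y' \<Longrightarrow> Y \<subseteq> Y' \<Longrightarrow> coeff (\<Gamma> p) 1 = (\<Sum>y\<in>Y'. b y * \<theta> (pdiff y p))"
      "\<And>Y'. finite Y' \<Longrightarrow> Z \<subseteq> Y' \<Longrightarrow> coeff (\<Gamma> q) 1 = (\<Sum>y\<in>Y'. b y * \<theta> (pdiff y q))"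
      by blast
    show ?case
    proof (intro exI[of _ "Y \<union> Z"] conjI allI impI)
      fix Y' assume "finite Y'" "Y \<union> Z \<subseteq> Y'"
      then show "coeff (\<Gamma> (p + q)) 1 = (\<Sum>y\<in>Y'. b y * \<theta> (pdiff y (p + q)))"
        using YZ(3)[of Y'] YZ(4)[of Y']
        by (simp add: \<Gamma> \<theta> pdiff_add distrib_left sum.distrib)
    qed (use YZ in simp)
  next
    case (mult p q)
    then obtain Y Z where YZ: "finite Y" "finite Z"
      "\<And>Y'. finite Y' \<Longrightarrow> Y \<subseteq> Y' \<Longrightarrow> coeff (\<Gamma> p) 1 = (\<Sum>y\<in>Y'. b y * \<theta> (pdiff y p))"
      "\<And>Y'. finite Y' \<Longrightarrow> Z \<subseteq> Y' \<Longrightarrow> coeff (\<Gamma> q) 1 = (\<Sum>y\<in>Y'. b y * \<theta> (pdiff y q))"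
      by blast
    show ?case
    proof (intro exI[of _ "Y \<union> Z"] conjI allI impI)
      fix Y' assume Y': "finite Y'" "Y \<union> Z \<subseteq> Y'"
      have "coeff (\<Gamma> (p * q)) 1 = coeff (\<Gamma> p) 1 * \<theta> q + \<theta> p * coeff (\<Gamma> q) 1"
        by (simp add: \<Gamma> coeff_mult c0 algebra_simps)
      also have "\<dots> = (\<Sum>y\<in>Y'. b y * \<theta> (pdiff y (p * q)))"
        using YZ(3)[of Y'] YZ(4)[of Y'] Y'
        by (simp add: \<theta> pdiff_mult distrib_left sum.distrib sum_distrib_left sum_distrib_right mult_ac)
      finally show "coeff (\<Gamma> (p * q)) 1 = (\<Sum>y\<in>Y'. b y * \<theta> (pdiff y (p * q)))" .
    qed (use YZ in simp)
  qed
qed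

section \<open>The generators in the coordinates \<open>x\<close> and \<open>p\<close>\<close>

text \<open>From here up to the change of variables, \<open>(U, r)\<close> is the variable \<open>x\<^sub>r\<close> and \<open>(V, r)\<close> is \<open>p\<^sub>r\<close>; so
  \<open>gen_coeff a r\<close> is the coefficient of \<open>z\<^sup>r\<close> in \<open>p(z) x(z)\<^sup>a\<close>.\<close>

abbreviation deg_wt :: "uv \<times> nat \<Rightarrow> nat" where "deg_wt \<equiv> \<lambda>(x, r). Suc r"
abbreviation U_wt :: "uv \<times> nat \<Rightarrow> nat" where "U_wt \<equiv> \<lambda>(x, r). if x = U then 1 else 0"
abbreviation V_wt :: "uv \<times> nat \<Rightarrow> nat" where "V_wt \<equiv> \<lambda>(x, r). if x = V then 1 else 0"

definition gen_coeff :: "nat \<Rightarrow> nat \<Rightarrow> (uv \<times> nat) mpoly" where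
  "gen_coeff a r = fps_nth (gen_series V * gen_series U ^ a) r"

text \<open>The generator \<open>gen_coeff a r\<close> has degree \<open>a + r + 1\<close>, as its terms have \<open>a + 1\<close> factors with indices
  adding up to \<open>r\<close>; so \<open>N\<close> is the degree of the product.\<close>

inductive gen_prod :: "nat \<Rightarrow> nat \<Rightarrow> (uv \<times> nat) mpoly \<Rightarrow> bool" where
  gen_prod_1: "gen_prod 0 0 1"
| gen_prod_step: "gen_prod k N f \<Longrightarrow> gen_prod (Suc k) (Suc (a + r) + N) (gen_coeff a r * f)"

definition gen_space :: "nat \<Rightarrow> nat \<Rightarrow> (uv \<times> nat) mpoly set" where
  "gen_space k N = mp.span {f. gen_prod k N f}"

lemma gen_prod_mult: "gen_prod k M f \<Longrightarrow> gen_prod l N g \<Longrightarrow> gen_prod (k + l) (M + N) (f * g)"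
proof (induction rule: gen_prod.induct)
  case (gen_prod_step k M f a r)
  then show ?case
    using gen_prod.gen_prod_step[of "k + l" "M + N" "f * g" a r] by (simp add: mult.assoc add.assoc)
qed simp

lemma gen_prod_gen_coeff: "gen_prod 1 (Suc (a + r)) (gen_coeff a r)"
  using gen_prod_step[OF gen_prod_1, of a r] by simp

lemma gen_space_mult:
  assumes "f \<in> gen_space k M" "g \<in> gen_space l N"
  shows "f * g \<in> gen_space (k + l) (M + N)"
  using assms(1) unfolding gen_space_def
proof (induction rule: mp.span_induct_alt)
  case (step c f1 f2)
  have "f1 * g \<in> mp.span {f. gen_prod (k + l) (M + N) f}"
    using assms(2) unfolding gen_space_def
  proof (induction rule: mp.span_induct_alt)
    case (step d g1 g2)
    then show ?case
      using \<open>f1 \<in> {f. gen_prod k M f}\<close>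
      by (simp add: distrib_left mscale_mult_right gen_prod_mult mp.span_add mp.span_scale mp.span_base)
  qed (simp add: mp.span_zero)
  then show ?case
    using step by (simp add: distrib_right mscale_mult_left mp.span_add mp.span_scale)
qed (simp add: mp.span_zero)

lemma subspace_gen_space: "mp.subspace (gen_space k N)"
  by (simp add: gen_space_def)

lemma homogeneous_gen_series:
  "homogeneous deg_wt (1 * n + 1) (fps_nth (gen_series x) n)"
  "homogeneous V_wt (0 * n + (if x = V then 1 else 0)) (fps_nth (gen_series x) n)"
  using homogeneous_mvar[of deg_wt "(x, n)"] homogeneous_mvar[of V_wt "(x, n)"]
  by (simp_all add: gen_series_def)

lemma homogeneous_gen_coeff:
  "homogeneous deg_wt (Suc (a + r)) (gen_coeff a r)" "homogeneous V_wt 1 (gen_coeff a r)"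
proof -
  have "homogeneous deg_wt (1 * r + (1 + a * 1)) (gen_coeff a r)"
    unfolding gen_coeff_def by (intro homogeneous_fps_mult homogeneous_fps_power homogeneous_gen_series)
  then show "homogeneous deg_wt (Suc (a + r)) (gen_coeff a r)"
    by (simp add: add_ac)
  have "homogeneous V_wt (0 * r + ((if V = V then 1 else 0) + a * (if U = V then 1 else 0))) (gen_coeff a r)"
    unfolding gen_coeff_def by (intro homogeneous_fps_mult homogeneous_fps_power homogeneous_gen_series)
  then show "homogeneous V_wt 1 (gen_coeff a r)"
    by simp
qed

lemma homogeneous_gen_prod:
  assumes "gen_prod k N f"
  shows "homogeneous deg_wt N f" "homogeneous V_wt k f"
  using assms
proof (induction)
  case (gen_prod_step k N f a r)
  { case 1 show ?case using homogeneous_mult[OF homogeneous_gen_coeff(1) gen_prod_step.IH(1)] . }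
  { case 2 show ?case using homogeneous_mult[OF homogeneous_gen_coeff(2)[of a r] gen_prod_step.IH(2)] by simp }
qed (simp_all add: homogeneous_1)

lemma homogeneous_gen_space:
  assumes "f \<in> gen_space k N"
  shows "homogeneous deg_wt N f" "homogeneous V_wt k f"
proof -
  have "mp.span {f. gen_prod k N f} \<subseteq> {f. homogeneous deg_wt N f}"
    by (rule mp.span_minimal) (use homogeneous_gen_prod in blast, rule subspace_homogeneous)
  then show "homogeneous deg_wt N f"
    using assms by (auto simp: gen_space_def)
  have "mp.span {f. gen_prod k N f} \<subseteq> {f. homogeneous V_wt k f}"
    by (rule mp.span_minimal) (use homogeneous_gen_prod in blast, rule subspace_homogeneous)
  then show "homogeneous V_wt k f"
    using assms by (auto simp: gen_space_def)
qed

section \<open>Standard coefficients determine an element\<close>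

definition standard :: "nat \<Rightarrow> (uv \<times> nat \<Rightarrow>\<^sub>0 nat) \<Rightarrow> bool" where
  "standard k m \<longleftrightarrow> wdegree V_wt m = k \<and> (\<forall>r. (U, r) \<in> keys m \<longrightarrow> r < k)"

definition gen_span :: "nat \<Rightarrow> (uv \<times> nat) mpoly set" where
  "gen_span k = mp.span {f. \<exists>N. gen_prod k N f}"

lemma subspace_gen_span: "mp.subspace (gen_span k)"
  by (simp add: gen_span_def)

lemma gen_space_subset_gen_span: "gen_space k N \<subseteq> gen_span k"
  unfolding gen_space_def gen_span_def by (rule mp.span_mono) auto

lemma homogeneous_gen_span: "f \<in> gen_span k \<Longrightarrow> homogeneous V_wt k f"
proof -
  have "mp.span {f. \<exists>N. gen_prod k N f} \<subseteq> {f. homogeneous V_wt k f}"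
    by (rule mp.span_minimal) (use homogeneous_gen_prod in blast, rule subspace_homogeneous)
  then show "f \<in> gen_span k \<Longrightarrow> homogeneous V_wt k f"
    by (auto simp: gen_span_def)
qed

abbreviation fps_pdiff :: "'v \<Rightarrow> 'v mpoly fps \<Rightarrow> 'v mpoly fps" where
  "fps_pdiff y F \<equiv> Abs_fps (\<lambda>n. pdiff y (fps_nth F n))"

lemma fps_pdiff_mult: "fps_pdiff y (F * G) = fps_pdiff y F * G + F * fps_pdiff y G"
  by (rule fps_ext) (simp add: fps_mult_nth pdiff_sum pdiff_mult sum.distrib)

lemma fps_pdiff_gen_series:
  "fps_pdiff (x, s) (gen_series y) = (if x = y then fps_X ^ s else 0)"
  by (rule fps_ext) (auto simp: gen_series_def pdiff_mvar)

lemma fps_pdiff_power: "fps_pdiff y (F ^ n) = of_nat n * F ^ (n - 1) * fps_pdiff y F"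
proof (induction n)
  case 0
  have "pdiff y 1 = 0"
    using pdiff_mconst[of y 1] by simp
  then show ?case
    by (intro fps_ext) simp
next
  case (Suc n)
  have "of_nat n * F ^ (n - 1) * F = of_nat n * F ^ n"
    by (cases n) (simp_all add: mult_ac)
  moreover have "F * (of_nat n * F ^ (n - 1) * fps_pdiff y F) =
      of_nat n * F ^ (n - 1) * F * fps_pdiff y F"
    by (simp only: mult_ac)
  ultimately have "F * (of_nat n * F ^ (n - 1) * fps_pdiff y F) = of_nat n * F ^ n * fps_pdiff y F"
    by simp
  then show ?case
    by (simp add: fps_pdiff_mult Suc distrib_right)
qed

lemma mconst_of_nat: "mconst (of_nat n) = of_nat n"
  by (induction n) (simp_all add: mconst_add)

lemma pdiff_gen_coeff:
  "pdiff (U, s) (gen_coeff a r) = (if s \<le> r then mscale (of_nat a) (gen_coeff (a - 1) (r - s)) else 0)"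
proof -
  have "fps_pdiff (U, s) (gen_series V * gen_series U ^ a) =
      fps_X ^ s * (of_nat a * (gen_series V * gen_series U ^ (a - 1)))"
    unfolding fps_pdiff_mult fps_pdiff_power fps_pdiff_gen_series by (simp add: mult_ac)
  then have "pdiff (U, s) (gen_coeff a r) =
      fps_nth (fps_X ^ s * (of_nat a * (gen_series V * gen_series U ^ (a - 1)))) r"
    unfolding gen_coeff_def by (metis fps_nth_Abs_fps)
  then show ?thesis
    by (simp add: fps_X_power_mult_nth gen_coeff_def mscale_def mconst_of_nat fps_of_nat[symmetric])
qed

lemma gen_span_mult_gen_coeff: "f \<in> gen_span k \<Longrightarrow> gen_coeff a r * f \<in> gen_span (Suc k)"
  unfolding gen_span_def
proof (induction rule: mp.span_induct_alt)
  case (step c f g)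
  then obtain N where "gen_prod k N f"
    by auto
  then have "gen_coeff a r * f \<in> mp.span {f. \<exists>N. gen_prod (Suc k) N f}"
    by (intro mp.span_base) (auto intro: gen_prod_step)
  then show ?case
    using step by (simp add: distrib_left mscale_mult_right mp.span_add mp.span_scale)
qed (simp add: mp.span_zero)

text \<open>By \<open>pdiff_gen_coeff\<close>, a derivation \<open>\<partial>/\<partial>x\<^sub>s\<close> maps each generator to a multiple of a generator.\<close>

lemma gen_span_pdiff: "f \<in> gen_span k \<Longrightarrow> pdiff (U, s) f \<in> gen_span k"
proof -
  have prod: "pdiff (U, s) f \<in> gen_span k" if "gen_prod k N f" for k N f
    using that
  proof (induction)
    case gen_prod_1
    have "pdiff (U, s) 1 = 0"
      using pdiff_mconst[of "(U, s)" 1] by simp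
    then show ?case
      by (simp add: mp.subspace_0[OF subspace_gen_span])
  next
    case (gen_prod_step k N f a r)
    have "f \<in> gen_span k"
      unfolding gen_span_def using gen_prod_step by (intro mp.span_base) auto
    then have "pdiff (U, s) (gen_coeff a r) * f \<in> gen_span (Suc k)"
      using gen_span_mult_gen_coeff subspace_gen_span
      by (auto simp: pdiff_gen_coeff mscale_mult_left intro: mp.subspace_scale mp.subspace_0)
    then show ?case
      unfolding pdiff_mult
      by (intro mp.subspace_add[OF subspace_gen_span] gen_span_mult_gen_coeff gen_prod_step.IH)
  qed
  assume "f \<in> gen_span k"
  then show ?thesis
    unfolding gen_span_def
  proof (induction rule: mp.span_induct_alt)
    case (step c f g)
    then show ?case
      using prod[of k _ f] unfolding gen_span_def
      by (auto simp: pdiff_add pdiff_mscale intro: mp.span_add mp.span_scale)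
  qed (simp add: mp.span_zero)
qed

text \<open>The substitution \<open>p(z) \<mapsto> (1 - \<epsilon>z) p(z)\<close>, \<open>x(z) \<mapsto> x(z) + \<delta> z\<^sup>r / (1 - \<epsilon>z)\<close>, with values in
  polynomials in \<open>\<delta>\<close> (the outer variable) over polynomials in \<open>\<epsilon>\<close>. The first order in \<open>\<delta>\<close> of the
  series \<open>p(z) x(z)\<^sup>a\<close> does not contain \<open>\<epsilon>\<close>, because the two factors \<open>1 - \<epsilon>z\<close> cancel.\<close>

definition shift_var :: "uv \<times> nat \<Rightarrow> (uv \<times> nat) mpoly poly" where
  "shift_var = (\<lambda>(x, s). if x = V \<and> s > 0 then [:mvar (x, s), - mvar (x, s - 1):] else [:mvar (x, s):])"

definition shift_dir :: "nat \<Rightarrow> uv \<times> nat \<Rightarrow> (uv \<times> nat) mpoly poly" where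
  "shift_dir r = (\<lambda>(x, s). if x = U \<and> s \<ge> r then monom 1 (s - r) else 0)"

definition shift_subst :: "nat \<Rightarrow> (uv \<times> nat) mpoly \<Rightarrow> (uv \<times> nat) mpoly poly poly" where
  "shift_subst r = msubst (\<lambda>c. [:[:mconst c:]:]) (\<lambda>x. [:shift_var x, shift_dir r x:])"

lemma power_add_first_order:
  fixes x y :: "'a::comm_ring_1"
  shows "\<exists>z. (x + y) ^ n = x ^ n + of_nat n * x ^ (n - 1) * y + y ^ 2 * z"
proof (induction n)
  case (Suc n)
  then obtain z where z: "(x + y) ^ n = x ^ n + of_nat n * x ^ (n - 1) * y + y ^ 2 * z"
    by blast
  have nn: "of_nat n * x ^ (n - 1) * x = of_nat n * x ^ n"
    by (cases n) (simp_all add: mult_ac)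
  have "(x + y) ^ Suc n = x * x ^ n + (of_nat n * x ^ (n - 1) * x) * y + x * y ^ 2 * z + y * x ^ n +
      y ^ 2 * (of_nat n * x ^ (n - 1)) + y ^ 2 * (y * z)"
    by (simp add: z algebra_simps power2_eq_square)
  also have "\<dots> = x ^ Suc n + of_nat (Suc n) * x ^ (Suc n - 1) * y +
      y ^ 2 * (x * z + of_nat n * x ^ (n - 1) + y * z)"
    unfolding nn by (simp add: algebra_simps)
  finally show ?case
    by blast
qed (auto intro: exI[of _ 0])

text \<open>The terms of order \<open>0\<close> and \<open>1\<close> in \<open>\<delta>\<close> are the coefficients of \<open>z\<^sup>j\<close> in \<open>(1 - \<epsilon>z) p(z) x(z)\<^sup>a\<close> and
  in \<open>a z\<^sup>r p(z) x(z)\<^sup>a\<^sup>-\<^sup>1\<close>, of degree at most \<open>1\<close> and \<open>0\<close> in \<open>\<epsilon>\<close>.\<close>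

lemma shift_subst_gen_coeff:
  "n > 1 \<Longrightarrow> coeff (coeff (shift_subst r (gen_coeff a j)) 0) n = 0"
  "n \<ge> 1 \<Longrightarrow> coeff (coeff (shift_subst r (gen_coeff a j)) 1) n = 0"
proof -
  define \<epsilon> \<delta> :: "(uv \<times> nat) mpoly poly poly" where "\<epsilon> = [:[:0, 1:]:]" and "\<delta> = [:0, 1:]"
  define cc :: "(uv \<times> nat) mpoly \<Rightarrow> (uv \<times> nat) mpoly poly poly" where "cc = (\<lambda>p. [:[:p:]:])"
  have cc: "cc (p + q) = cc p + cc q" "cc (p * q) = cc p * cc q" "cc 0 = 0" "cc 1 = 1" for p q
    by (simp_all add: cc_def one_pCons)
  have cc_sum: "cc (\<Sum>i\<in>S. p i) = (\<Sum>i\<in>S. cc (p i))" for S and p :: "'i \<Rightarrow> _"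
    by (induction S rule: infinite_finite_induct) (simp_all add: cc)
  define L where "L F = Abs_fps (\<lambda>n. cc (fps_nth F n))" for F
  have L_mult: "L (F * G) = L F * L G" for F G
    by (rule fps_ext) (simp add: L_def fps_mult_nth cc cc_sum)
  have L_1: "L 1 = 1"
    by (rule fps_ext) (simp add: L_def cc)
  have L_power: "L (F ^ n) = L F ^ n" for F n
    by (induction n) (simp_all add: L_mult L_1)
  define u v where "u = L (gen_series U)" and "v = L (gen_series V)"
  define D where "D = fps_const \<delta> * (fps_X ^ r * Abs_fps (\<lambda>n. \<epsilon> ^ n))"
  define e where "e = 1 - fps_const \<epsilon> * fps_X"
  let ?\<Gamma> = "poly_poly_mconst.msubst_fps (\<lambda>x. [:shift_var x, shift_dir r x:])"
  have \<epsilon>_power: "\<epsilon> ^ n = [:monom 1 n:]" for n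
    by (induction n) (simp_all add: \<epsilon>_def one_pCons monom_Suc)
  have eD: "e * D = fps_const \<delta> * fps_X ^ r"
  proof -
    have "e * Abs_fps (\<lambda>n. \<epsilon> ^ n) = 1"
    proof (rule fps_ext)
      show "fps_nth (e * Abs_fps (\<lambda>n. \<epsilon> ^ n)) n = fps_nth 1 n" for n
        by (cases n) (simp_all add: e_def left_diff_distrib mult.assoc)
    qed
    moreover have "e * D = fps_const \<delta> * fps_X ^ r * (e * Abs_fps (\<lambda>n. \<epsilon> ^ n))"
      unfolding D_def by (simp only: mult_ac)
    ultimately show ?thesis
      by simp
  qed
  have \<Gamma>V: "?\<Gamma> (gen_series V) = e * v"
  proof (rule fps_ext)
    show "fps_nth (?\<Gamma> (gen_series V)) n = fps_nth (e * v) n" for n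
      by (cases n) (simp_all add: e_def v_def L_def gen_series_def left_diff_distrib mult.assoc cc_def
        \<epsilon>_def poly_poly_mconst.msubst_mvar shift_var_def shift_dir_def)
  qed
  have \<Gamma>U: "?\<Gamma> (gen_series U) = u + D"
  proof (rule fps_ext)
    show "fps_nth (?\<Gamma> (gen_series U)) n = fps_nth (u + D) n" for n
      by (simp add: D_def u_def L_def gen_series_def cc_def \<epsilon>_power fps_X_power_mult_nth
        \<delta>_def poly_poly_mconst.msubst_mvar shift_var_def shift_dir_def)
  qed
  obtain z where z: "(u + D) ^ a = u ^ a + of_nat a * u ^ (a - 1) * D + D ^ 2 * z"
    using power_add_first_order by blast
  \<comment> \<open>\<open>\<delta>\<^sup>2 w\<close> collects everything of order at least two in \<open>\<delta>\<close>\<close>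
  define w where "w = v * e * (fps_X ^ r * Abs_fps (\<lambda>n. \<epsilon> ^ n)) ^ 2 * z"
  have "?\<Gamma> (gen_series V * gen_series U ^ a) = e * v * (u + D) ^ a"
    by (simp add: poly_poly_mconst.msubst_fps_mult poly_poly_mconst.msubst_fps_power \<Gamma>U \<Gamma>V)
  also have "\<dots> = e * (v * u ^ a) + (e * D) * (of_nat a * (v * u ^ (a - 1))) + D ^ 2 * (v * e * z)"
    unfolding z by (simp add: algebra_simps)
  also have "D ^ 2 * (v * e * z) = fps_const (\<delta> ^ 2) * w"
    unfolding D_def w_def power_mult_distrib by (simp add: fps_const_power mult_ac)
  also have "e * (v * u ^ a) = L (gen_series V * gen_series U ^ a) -
      fps_const \<epsilon> * (fps_X * L (gen_series V * gen_series U ^ a))"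
    by (simp add: L_mult L_power u_def v_def e_def left_diff_distrib mult.assoc)
  also have "(e * D) * (of_nat a * (v * u ^ (a - 1))) =
      fps_const \<delta> * (fps_X ^ r * (of_nat a * L (gen_series V * gen_series U ^ (a - 1))))"
    unfolding eD by (simp add: L_mult L_power u_def v_def mult_ac)
  finally have "fps_nth (?\<Gamma> (gen_series V * gen_series U ^ a)) j =
      fps_nth (L (gen_series V * gen_series U ^ a) -
        fps_const \<epsilon> * (fps_X * L (gen_series V * gen_series U ^ a)) +
        fps_const \<delta> * (fps_X ^ r * (of_nat a * L (gen_series V * gen_series U ^ (a - 1)))) +
        fps_const (\<delta> ^ 2) * w) j"
    by simp
  moreover have "(of_nat a :: (uv \<times> nat) mpoly poly poly) = [:of_nat a:]"
    by (simp add: of_nat_poly)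
  moreover have "(of_nat a :: (uv \<times> nat) mpoly poly) = [:of_nat a:]"
    by (simp add: of_nat_poly)
  ultimately have main: "shift_subst r (gen_coeff a j) = cc (gen_coeff a j) -
      \<epsilon> * (if j = 0 then 0 else cc (gen_coeff a (j - 1))) +
      \<delta> * (if j < r then 0 else cc (of_nat a * gen_coeff (a - 1) (j - r))) +
      \<delta> ^ 2 * fps_nth w j"
    by (simp add: shift_subst_def gen_coeff_def L_def fps_X_power_mult_nth fps_of_nat[symmetric] cc_def)
  show "n > 1 \<Longrightarrow> coeff (coeff (shift_subst r (gen_coeff a j)) 0) n = 0"
    unfolding main by (simp add: \<delta>_def \<epsilon>_def cc_def power2_eq_square coeff_pCons split: nat.splits)
  show "n \<ge> 1 \<Longrightarrow> coeff (coeff (shift_subst r (gen_coeff a j)) 1) n = 0"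
    unfolding main by (simp add: \<delta>_def \<epsilon>_def cc_def power2_eq_square coeff_pCons split: nat.splits)
qed

text \<open>In the first order in \<open>\<delta>\<close> of a product of \<open>k\<close> generators, one factor is free of \<open>\<epsilon>\<close> and the others
  are at most linear in \<open>\<epsilon>\<close>: the degree in \<open>\<epsilon>\<close> is less than \<open>k\<close>.\<close>

lemma shift_subst_gen_prod:
  assumes "gen_prod k N f"
  shows "n > k \<Longrightarrow> coeff (coeff (shift_subst r f) 0) n = 0"
    and "n \<ge> k \<Longrightarrow> coeff (coeff (shift_subst r f) 1) n = 0"
  using assms
proof (induction arbitrary: n)
  case gen_prod_1
  { case 1 then show ?case by (simp add: shift_subst_def poly_poly_mconst.msubst_1) }
  { case 2 then show ?case by (simp add: shift_subst_def poly_poly_mconst.msubst_1) }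
next
  case (gen_prod_step k N f a j)
  let ?g = "shift_subst r (gen_coeff a j)" and ?f = "shift_subst r f"
  have mult: "shift_subst r (gen_coeff a j * f) = ?g * ?f"
    by (simp add: shift_subst_def poly_poly_mconst.msubst_mult)
  { case 1
    have "coeff (coeff ?g 0) i * coeff (coeff ?f 0) (n - i) = 0" for i
      using 1 shift_subst_gen_coeff(1)[of i r a j] gen_prod_step.IH(1)[of "n - i"]
      by (cases "i > 1") auto
    then show ?case
      unfolding mult by (simp add: coeff_mult) }
  { case 2
    have "coeff (coeff ?g 1) i * coeff (coeff ?f 0) (n - i) = 0" for i
      using 2 shift_subst_gen_coeff(2)[of i r a j] gen_prod_step.IH(1)[of "n - i"]
      by (cases "i \<ge> 1") auto
    moreover have "coeff (coeff ?g 0) i * coeff (coeff ?f 1) (n - i) = 0" for i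
      using 2 shift_subst_gen_coeff(1)[of i r a j] gen_prod_step.IH(2)[of "n - i"]
      by (cases "i > 1") auto
    ultimately show ?case
      unfolding mult by (simp add: coeff_mult) }
qed

lemma shift_subst_gen_span:
  assumes "f \<in> gen_span k"
  shows "coeff (coeff (shift_subst r f) 1) k = 0"
  using assms unfolding gen_span_def
proof (induction rule: mp.span_induct_alt)
  case base
  then show ?case
    by (simp add: shift_subst_def poly_poly_mconst.msubst_0)
next
  case (step c f g)
  then have "coeff (coeff (shift_subst r f) 1) k = 0"
    using shift_subst_gen_prod(2) by blast
  then show ?case
    using step by (simp add: shift_subst_def poly_poly_mconst.msubst_add poly_poly_mconst.msubst_mscale)
qed

text \<open>By the chain rule, the first order in \<open>\<delta>\<close> is \<open>\<Sum>\<^sub>s\<^sub>\<ge>\<^sub>r \<epsilon>\<^sup>s\<^sup>-\<^sup>r \<theta>(\<partial>f/\<partial>x\<^sub>s)\<close>, where \<open>\<theta>\<close> substitutes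
  \<open>(1 - \<epsilon>z) p(z)\<close> for \<open>p(z)\<close>. Its coefficient at \<open>\<epsilon>\<^sup>k\<close> vanishes on \<open>gen_span k\<close>, and this is Newton's
  recursion. If \<open>\<partial>f/\<partial>x\<^sub>s\<close> vanishes for \<open>s < r + k\<close>, the only remaining contribution to it is
  \<open>\<partial>f/\<partial>x\<^sub>r\<^sub>+\<^sub>k\<close>.\<close>

lemma pdiff_determined:
  assumes "f \<in> gen_span k" "\<And>s. s < r + k \<Longrightarrow> pdiff (U, s) f = 0"
  shows "pdiff (U, r + k) f = 0"
proof -
  define \<theta> where "\<theta> = msubst (\<lambda>c. [:mconst c:]) shift_var"
  have \<theta>_0: "\<theta> 0 = 0"
    by (simp add: \<theta>_def poly_mconst.msubst_0)
  have \<theta>_coeff: "coeff (\<theta> p) 0 = p" for p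
    by (induction p rule: mpoly_induct)
      (auto simp: \<theta>_def poly_mconst.msubst_simps shift_var_def coeff_mult split: prod.splits)
  obtain Y where Y: "finite Y" "\<And>Y'. finite Y' \<Longrightarrow> Y \<subseteq> Y' \<Longrightarrow>
      coeff (shift_subst r f) 1 = (\<Sum>y\<in>Y'. shift_dir r y * \<theta> (pdiff y f))"
    using msubst_first_order[of shift_var "shift_dir r" f] unfolding shift_subst_def \<theta>_def by blast
  define Y' where "Y' = insert (U, r + k) Y"
  have "0 = coeff (coeff (shift_subst r f) 1) k"
    using shift_subst_gen_span[OF assms(1)] by simp
  also have "\<dots> = (\<Sum>y\<in>Y'. coeff (shift_dir r y * \<theta> (pdiff y f)) k)"
    using Y by (subst Y(2)[of Y']) (auto simp: Y'_def coeff_sum)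
  also have "\<dots> = (\<Sum>y\<in>Y'. if y = (U, r + k) then pdiff y f else 0)"
  proof (rule sum.cong[OF refl])
    fix y :: "uv \<times> nat"
    obtain x s where y: "y = (x, s)"
      by fastforce
    consider "y = (U, r + k)" | "x = V \<or> s < r" | "x = U" "r \<le> s" "s < r + k" | "x = U" "s > r + k"
      using y by (metis (full_types) linorder_neqE_nat not_le uv.exhaust)
    then show "coeff (shift_dir r y * \<theta> (pdiff y f)) k = (if y = (U, r + k) then pdiff y f else 0)"
      by cases (auto simp: y shift_dir_def assms(2) \<theta>_0 \<theta>_coeff coeff_monom_mult)
  qed
  also have "\<dots> = pdiff (U, r + k) f"
    using Y by (simp add: Y'_def)
  finally show ?thesis
    by simp
qed

text \<open>The derivatives \<open>\<partial>f/\<partial>x\<^sub>s\<close> with \<open>s < k\<close> again have vanishing standard coefficients, so they are \<open>0\<close> by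
  induction on the degree in \<open>x\<close>. Then all derivatives vanish by \<open>pdiff_determined\<close>, so \<open>f\<close> does not
  involve \<open>x\<close>, and its monomials are standard.\<close>

lemma gen_span_eq_0I:
  assumes "f \<in> gen_span k" "\<And>m. standard k m \<Longrightarrow> lookup f m = 0"
  shows "f = 0"
proof -
  have "f = 0" if "\<And>m. lookup f m \<noteq> 0 \<Longrightarrow> wdegree U_wt m \<le> n" "f \<in> gen_span k"
    "\<And>m. standard k m \<Longrightarrow> lookup f m = 0" for n f
    using that
  proof (induction n arbitrary: f)
    case (0 f)
    show ?case
    proof (rule poly_mapping_eqI)
      fix m
      have "lookup f m = 0"
      proof (rule ccontr)
        assume m: "lookup f m \<noteq> 0"
        then have "wdegree U_wt m = 0"
          using 0(1) by blast
        have "(U, r) \<notin> keys m" for r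
        proof
          assume r: "(U, r) \<in> keys m"
          have "lookup m (U, r) * U_wt (U, r) \<le> wdegree U_wt m"
            unfolding wdegree_def by (rule member_le_sum[OF r]) simp_all
          then show False
            using r \<open>wdegree U_wt m = 0\<close> by (simp add: in_keys_iff)
        qed
        moreover have "wdegree V_wt m = k"
          using homogeneousD[OF homogeneous_gen_span[OF 0(2)] m] .
        ultimately have "standard k m"
          by (simp add: standard_def)
        then show False
          using 0(3) m by blast
      qed
      then show "lookup f m = lookup 0 m"
        by simp
    qed
  next
    case (Suc n f)
    have IH: "pdiff (U, s) f = 0" if "s < k" for s
    proof (rule Suc.IH)
      fix m
      assume "lookup (pdiff (U, s) f) m \<noteq> 0"
      then have "lookup f (m + single (U, s) 1) \<noteq> 0"
        by (auto simp: lookup_pdiff)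
      then show "wdegree U_wt m \<le> n"
        using Suc.prems(1) by (fastforce simp: wdegree_add)
    next
      show "pdiff (U, s) f \<in> gen_span k"
        using Suc.prems(2) by (rule gen_span_pdiff)
    next
      fix m
      assume "standard k m"
      then have "standard k (m + single (U, s) 1)"
        using that by (auto simp: standard_def wdegree_add in_keys_iff lookup_add lookup_single when_def)
      then show "lookup (pdiff (U, s) f) m = 0"
        using Suc.prems(3) by (simp add: lookup_pdiff)
    qed
    have all: "pdiff (U, s) f = 0" for s
    proof (induction s rule: less_induct)
      case (less s)
      show ?case
      proof (cases "s < k")
        case False
        then show ?thesis
          using pdiff_determined[OF Suc.prems(2), of "s - k"] less by simp
      qed (rule IH)
    qed
    show ?case
    proof (rule poly_mapping_eqI)
      fix m
      have "lookup f m = 0"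
      proof (rule ccontr)
        assume m: "lookup f m \<noteq> 0"
        have "(U, s) \<notin> keys m" for s
        proof
          assume "(U, s) \<in> keys m"
          then have "lookup f (m - single (U, s) 1 + single (U, s) 1) = lookup f m"
            by (simp add: add_single_minus in_keys_iff del: One_nat_def)
          moreover have "lookup (pdiff (U, s) f) (m - single (U, s) 1) = 0"
            by (simp add: all)
          ultimately show False
            using m by (simp add: lookup_pdiff del: of_nat_Suc)
        qed
        moreover have "wdegree V_wt m = k"
          using homogeneousD[OF homogeneous_gen_span[OF Suc.prems(2)] m] .
        ultimately have "standard k m"
          by (simp add: standard_def)
        then show False
          using Suc.prems(3) m by blast
      qed
      then show "lookup f m = lookup 0 m"
        by simp
    qed
  qed
  note * = this
  have "wdegree U_wt m \<le> Max (wdegree U_wt ` keys f)" if "lookup f m \<noteq> 0" for m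
    using that by (intro Max_ge) (auto simp: in_keys_iff)
  then show ?thesis
    using * assms by blast
qed

section \<open>Standard coefficients are arbitrary\<close>

text \<open>The weights \<open>w z\<close> are the coefficients at \<open>T\<^sup>r\<close> of the Lagrange interpolation polynomials \<open>L z\<close>: the
  identity compares the coefficients in \<open>\<Sum>\<^sub>z z\<^sup>s L z = T\<^sup>s\<close>.\<close>

lemma dual_vandermonde:
  fixes Z :: "complex set"
  assumes "finite Z" "r < card Z"
  shows "\<exists>w. \<forall>s<card Z. (\<Sum>z\<in>Z. w z * z ^ s) = (if s = r then 1 else 0)"
proof -
  \<comment> \<open>the Lagrange interpolation polynomial with value \<open>1\<close> at \<open>z\<close> and \<open>0\<close> at the other points\<close>
  define L where "L z = smult (inverse (\<Prod>y\<in>Z - {z}. z - y)) (\<Prod>y\<in>Z - {z}. [:- y, 1:])" for z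
  have val: "poly (L z) x = (if x = z then 1 else 0)" if "z \<in> Z" "x \<in> Z" for x z
    using that assms(1) by (auto simp: L_def poly_prod)
  have deg: "degree (L z) < card Z" if "z \<in> Z" for z
  proof -
    have "degree (\<Prod>y\<in>Z - {z}. [:- y, 1:]) \<le> sum (degree \<circ> (\<lambda>y. [:- y, 1:])) (Z - {z})"
      by (rule degree_prod_sum_le) (use assms in simp)
    also have "\<dots> < card Z"
      using that assms by (simp add: card_gt_0_iff)
    finally show ?thesis
      unfolding L_def using degree_smult_le le_less_trans by blast
  qed
  have "(\<Sum>z\<in>Z. coeff (L z) r * z ^ s) = (if s = r then 1 else 0)" if "s < card Z" for s
  proof -
    have "(\<Sum>z\<in>Z. smult (z ^ s) (L z)) = monom 1 s"
    proof (rule poly_eqI_degree)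
      fix x assume "x \<in> Z"
      then have "poly (\<Sum>z\<in>Z. smult (z ^ s) (L z)) x = (\<Sum>z\<in>Z. if x = z then z ^ s else 0)"
        by (simp add: poly_sum val if_distrib cong: if_cong)
      then show "poly (\<Sum>z\<in>Z. smult (z ^ s) (L z)) x = poly (monom 1 s) x"
        using \<open>x \<in> Z\<close> assms by (simp add: poly_monom)
    next
      show "degree (monom (1::complex) s) < card Z"
        using that by (simp add: degree_monom_eq)
      show "degree (\<Sum>z\<in>Z. smult (z ^ s) (L z)) < card Z"
        using that assms deg by (intro degree_sum_less) (auto intro: le_less_trans[OF degree_smult_le])
    qed
    then have "coeff (\<Sum>z\<in>Z. smult (z ^ s) (L z)) r = coeff (monom 1 s) r"
      by simp
    then show ?thesis
      by (simp add: coeff_sum mult.commute)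
  qed
  then show ?thesis
    by (intro exI[of _ "\<lambda>z. coeff (L z) r"] allI impI)
qed

text \<open>The ideal generated by the \<open>x\<^sub>r\<close> with \<open>r \<ge> k\<close>. Working modulo this ideal means to look at standard
  coefficients only.\<close>

definition high_ideal :: "nat \<Rightarrow> (uv \<times> nat) mpoly set" where
  "high_ideal k = {f. \<forall>m\<in>keys f. \<exists>r\<ge>k. (U, r) \<in> keys m}"

lemma subspace_high_ideal: "mp.subspace (high_ideal k)"
proof (rule mp.subspaceI)
  fix f g assume "f \<in> high_ideal k" "g \<in> high_ideal k"
  then show "f + g \<in> high_ideal k"
    using keys_add[of f g] unfolding high_ideal_def by blast
next
  fix c f assume "f \<in> high_ideal k"
  then show "mscale c f \<in> high_ideal k"
    by (auto simp: high_ideal_def in_keys_iff)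
qed (simp add: high_ideal_def)

lemma high_ideal_mult:
  assumes "g \<in> high_ideal k"
  shows "f * g \<in> high_ideal k"
  unfolding high_ideal_def
proof (intro CollectI ballI)
  fix m assume "m \<in> keys (f * g)"
  then obtain a b where ab: "m = a + b" "b \<in> keys g"
    using keys_mult[of f g] by blast
  then obtain r where "r \<ge> k" "(U, r) \<in> keys b"
    using assms unfolding high_ideal_def by blast
  then show "\<exists>r\<ge>k. (U, r) \<in> keys m"
    using ab by (intro exI[of _ r]) (simp add: in_keys_iff lookup_add)
qed

lemma mvar_high_ideal: "r \<ge> k \<Longrightarrow> mvar (U, r) \<in> high_ideal k"
  by (auto simp: high_ideal_def mvar_def)

lemma lookup_high_ideal:
  assumes "f \<in> high_ideal k" "standard k m"
  shows "lookup f m = 0"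
proof (rule ccontr)
  assume "lookup f m \<noteq> 0"
  then have "m \<in> keys f"
    by (simp add: in_keys_iff)
  then obtain r where "r \<ge> k" "(U, r) \<in> keys m"
    using assms(1) unfolding high_ideal_def by blast
  then show False
    using assms(2) by (auto simp: standard_def)
qed

definition mod_space :: "nat \<Rightarrow> nat \<Rightarrow> (uv \<times> nat) mpoly set" where
  "mod_space k N = {f. \<exists>g\<in>gen_space k N. f - g \<in> high_ideal k}"

lemma subspace_mod_space: "mp.subspace (mod_space k N)"
proof (rule mp.subspaceI)
  show "0 \<in> mod_space k N"
    using mp.subspace_0[OF subspace_gen_space] mp.subspace_0[OF subspace_high_ideal]
    by (auto simp: mod_space_def intro!: bexI[of _ 0])
next
  fix f f' assume "f \<in> mod_space k N" "f' \<in> mod_space k N"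
  then obtain g g' where g: "g \<in> gen_space k N" "f - g \<in> high_ideal k" "g' \<in> gen_space k N"
    "f' - g' \<in> high_ideal k"
    by (auto simp: mod_space_def)
  then have "g + g' \<in> gen_space k N" "(f - g) + (f' - g') \<in> high_ideal k"
    using mp.subspace_add[OF subspace_gen_space] mp.subspace_add[OF subspace_high_ideal] by blast+
  then show "f + f' \<in> mod_space k N"
    by (auto simp: mod_space_def algebra_simps intro!: bexI[of _ "g + g'"])
next
  fix c f assume "f \<in> mod_space k N"
  then obtain g where g: "g \<in> gen_space k N" "f - g \<in> high_ideal k"
    by (auto simp: mod_space_def)
  then have "mscale c g \<in> gen_space k N" "mscale c (f - g) \<in> high_ideal k"
    using mp.subspace_scale[OF subspace_gen_space] mp.subspace_scale[OF subspace_high_ideal] by blast+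
  then show "mscale c f \<in> mod_space k N"
    by (auto simp: mod_space_def mp.scale_right_diff_distrib)
qed

lemma mod_space_diff_high:
  assumes "f \<in> mod_space k N" "h \<in> high_ideal k"
  shows "f - h \<in> mod_space k N"
proof -
  obtain g where g: "g \<in> gen_space k N" "f - g \<in> high_ideal k"
    using assms by (auto simp: mod_space_def)
  have eq: "f - h - g = (f - g) - h"
    by simp
  have "f - h - g \<in> high_ideal k"
    unfolding eq by (rule mp.subspace_diff[OF subspace_high_ideal g(2) assms(2)])
  then show ?thesis
    using g(1) unfolding mod_space_def by blast
qed

text \<open>The series \<open>x(z)\<close> or \<open>p(z)\<close> for a complex number \<open>z\<close>, with an auxiliary variable that records the
  degree: the term \<open>x\<^sub>r z\<^sup>r\<close> occurs at the power \<open>r + 1\<close>. Thus the coefficients of products are finite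
  sums and automatically homogeneous.\<close>

definition eval_series :: "complex \<Rightarrow> uv \<Rightarrow> (uv \<times> nat) mpoly fps" where
  "eval_series z x = Abs_fps (\<lambda>N. if N = 0 then 0 else mscale (z ^ (N - 1)) (mvar (x, N - 1)))"

lemma eval_series_nth: "fps_nth (eval_series z V * eval_series z U ^ a) N =
    (if N \<le> a then 0 else mscale (z ^ (N - Suc a)) (gen_coeff a (N - Suc a)))"
proof -
  define sc :: "(uv \<times> nat) mpoly fps \<Rightarrow> (uv \<times> nat) mpoly fps" where
    "sc F = Abs_fps (\<lambda>n. mscale (z ^ n) (fps_nth F n))" for F
  have sc_mult: "sc (F * G) = sc F * sc G" for F G
  proof (rule fps_ext)
    fix n
    show "fps_nth (sc (F * G)) n = fps_nth (sc F * sc G) n"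
      unfolding sc_def fps_nth_Abs_fps fps_mult_nth mp.scale_sum_right
      by (rule sum.cong)
        (simp_all add: mscale_mult_left mscale_mult_right mp.scale_scale flip: power_add)
  qed
  have sc_power: "sc (F ^ n) = sc F ^ n" for F n
  proof (induction n)
    case 0
    show ?case
      by (rule fps_ext) (simp add: sc_def)
  qed (simp add: sc_mult)
  have ev: "eval_series z x = fps_X * sc (gen_series x)" for x
    by (rule fps_ext) (simp add: eval_series_def sc_def gen_series_def)
  have "eval_series z V * eval_series z U ^ a = fps_X ^ Suc a * sc (gen_series V * gen_series U ^ a)"
    unfolding ev sc_mult sc_power power_mult_distrib by (simp add: mult_ac)
  then show ?thesis
    unfolding fps_X_power_mult_nth by (auto simp: fps_X_power_mult_nth sc_def gen_coeff_def simp del: power_Suc)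
qed

lemma eval_series_gen_space: "fps_nth (eval_series z V * eval_series z U ^ a) N \<in> gen_space 1 N"
proof (cases "N \<le> a")
  case True
  then show ?thesis
    using mp.subspace_0[OF subspace_gen_space] by (simp add: eval_series_nth)
next
  case False
  then have "gen_prod 1 N (gen_coeff a (N - Suc a))"
    using gen_prod_gen_coeff[of a "N - Suc a"] by simp
  then have "gen_coeff a (N - Suc a) \<in> gen_space 1 N"
    unfolding gen_space_def by (intro mp.span_base) simp
  then show ?thesis
    using False mp.subspace_scale[OF subspace_gen_space] by (simp add: eval_series_nth)
qed

lemma gen_space_fps_mult:
  assumes "\<And>N. fps_nth F N \<in> gen_space k N" "\<And>N. fps_nth G N \<in> gen_space l N"
  shows "fps_nth (F * G) N \<in> gen_space (k + l) N"
  unfolding fps_mult_nth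
proof (rule mp.subspace_sum[OF subspace_gen_space])
  fix i assume "i \<in> {0..N}"
  then show "fps_nth F i * fps_nth G (N - i) \<in> gen_space (k + l) N"
    using gen_space_mult[OF assms(1)[of i] assms(2)[of "N - i"]] by simp
qed

lemma one_gen_space: "fps_nth 1 N \<in> gen_space 0 N"
proof (cases "N = 0")
  case True
  have "1 \<in> gen_space 0 0"
    unfolding gen_space_def by (intro mp.span_base) (simp add: gen_prod_1)
  then show ?thesis
    using True by simp
qed (simp add: mp.subspace_0[OF subspace_gen_space])

definition eval_prod :: "complex set \<Rightarrow> (complex \<Rightarrow> nat) \<Rightarrow> (uv \<times> nat) mpoly fps" where
  "eval_prod Z a = (\<Prod>z\<in>Z. eval_series z V * eval_series z U ^ a z)"

lemma eval_prod_gen_space: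
  assumes "finite Z"
  shows "fps_nth (eval_prod Z a) N \<in> gen_space (card Z) N"
  using assms
proof (induction Z arbitrary: N rule: finite_induct)
  case empty
  then show ?case
    using one_gen_space by (simp add: eval_prod_def)
next
  case (insert z Z)
  have "fps_nth ((eval_series z V * eval_series z U ^ a z) * eval_prod Z a) N \<in> gen_space (1 + card Z) N"
    by (rule gen_space_fps_mult[OF eval_series_gen_space insert.IH])
  then show ?case
    using insert by (simp add: eval_prod_def)
qed

definition var_series :: "uv \<Rightarrow> nat multiset \<Rightarrow> (uv \<times> nat) mpoly fps" where
  "var_series x M = (\<Prod>r\<in>#M. fps_const (mvar (x, r)) * fps_X ^ Suc r)"

lemma var_series_add_mset:
  "var_series x (add_mset r M) = var_series x M * (fps_const (mvar (x, r)) * fps_X ^ Suc r)"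
  by (simp add: var_series_def mult_ac)

lemma fps_nth_mscale_const: "fps_nth (fps_const (mconst c) * F) N = mscale c (fps_nth F N)"
  by (simp add: mscale_def)

text \<open>For \<open>k\<close> distinct numbers \<open>z\<close> the dual Vandermonde weights give \<open>\<Sum>\<^sub>z w z x(z) = x\<^sub>r\<close> modulo the variables
  \<open>x\<^sub>s\<close> with \<open>s \<ge> k\<close>. Hence the factors \<open>x\<^sub>r\<close>, \<open>r < k\<close>, can be produced one by one next to \<open>\<Prod>\<^sub>z p(z)\<close>. The
  exponents \<open>a\<close> are arbitrary in the statement since each of these steps combines the products in
  which one of the exponents is raised by one.\<close>

lemma mod_space_x_monomials:
  assumes "finite Z" "\<forall>r\<in>#R. r < card Z"
  shows "fps_nth (var_series U R * eval_prod Z a) N \<in> mod_space (card Z) N"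
  using assms(2)
proof (induction R arbitrary: a N)
  case empty
  have "fps_nth (eval_prod Z a) N \<in> gen_space (card Z) N"
    by (rule eval_prod_gen_space[OF assms(1)])
  then show ?case
    using mp.subspace_0[OF subspace_high_ideal, of "card Z"]
    by (auto simp: var_series_def mod_space_def intro!: bexI[of _ "fps_nth (eval_prod Z a) N"])
next
  case (add r R)
  let ?k = "card Z"
  have r: "r < ?k" "\<forall>r\<in>#R. r < ?k"
    using add.prems by auto
  obtain w where w: "\<And>s. s < ?k \<Longrightarrow> (\<Sum>z\<in>Z. w z * z ^ s) = (if s = r then 1 else 0)"
    using dual_vandermonde[OF assms(1) r(1)] by blast
  define H where "H = var_series U R * eval_prod Z a"
  define S where "S = (\<Sum>z\<in>Z. fps_const (mconst (w z)) * eval_series z U)"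
  \<comment> \<open>the error in \<open>S = x\<^sub>r\<close>; it only involves \<open>x\<^sub>s\<close> with \<open>s \<ge> k\<close>\<close>
  define E where "E = S - fps_const (mvar (U, r)) * fps_X ^ Suc r"
  have upd: "eval_prod Z (a(z := Suc (a z))) = eval_prod Z a * eval_series z U" if "z \<in> Z" for z
  proof -
    have "eval_prod (Z - {z}) (a(z := Suc (a z))) = eval_prod (Z - {z}) a"
      unfolding eval_prod_def by (rule prod.cong) auto
    then show ?thesis
      using that assms(1) unfolding eval_prod_def by (simp add: prod.remove[of Z z] mult_ac)
  qed
  have "fps_nth (H * S) N \<in> mod_space ?k N"
  proof -
    have "H * S = (\<Sum>z\<in>Z. fps_const (mconst (w z)) * (var_series U R * eval_prod Z (a(z := Suc (a z)))))"
      unfolding S_def sum_distrib_left by (rule sum.cong) (simp_all add: H_def upd mult_ac)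
    then have "fps_nth (H * S) N =
        (\<Sum>z\<in>Z. mscale (w z) (fps_nth (var_series U R * eval_prod Z (a(z := Suc (a z)))) N))"
      by (simp only: fps_sum_nth fps_nth_mscale_const)
    then show ?thesis
      using add.IH[OF r(2)] mp.subspace_scale[OF subspace_mod_space]
      by (simp only:) (rule mp.subspace_sum[OF subspace_mod_space], blast)
  qed
  moreover have "fps_nth (H * E) N \<in> high_ideal ?k"
  proof -
    have E: "fps_nth E n \<in> high_ideal ?k" for n
    proof (cases n)
      case 0
      then show ?thesis
        using mp.subspace_0[OF subspace_high_ideal]
        by (simp add: E_def S_def fps_sum_nth eval_series_def)
    next
      case (Suc s)
      have "fps_nth S n = mscale (\<Sum>z\<in>Z. w z * z ^ s) (mvar (U, s))"
        unfolding S_def fps_sum_nth fps_nth_mscale_const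
        by (simp add: eval_series_def Suc mp.scale_sum_left)
      then have nth: "fps_nth E n = mscale ((\<Sum>z\<in>Z. w z * z ^ s) - (if s = r then 1 else 0)) (mvar (U, s))"
        by (auto simp: E_def Suc mp.scale_left_diff_distrib fps_X_power_mult_right_nth simp del: power_Suc)
      show ?thesis
      proof (cases "s < ?k")
        case True
        then show ?thesis
          using w[of s] mp.subspace_0[OF subspace_high_ideal] by (simp add: nth)
      next
        case False
        then show ?thesis
          unfolding nth by (intro mp.subspace_scale[OF subspace_high_ideal] mvar_high_ideal) simp
      qed
    qed
    show ?thesis
      unfolding fps_mult_nth by (intro mp.subspace_sum[OF subspace_high_ideal] high_ideal_mult E)
  qed
  moreover have "var_series U (add_mset r R) * eval_prod Z a = H * S - H * E"
    by (simp add: H_def E_def var_series_add_mset algebra_simps)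
  ultimately show ?case
    using mod_space_diff_high by simp
qed

text \<open>The product \<open>\<Prod>\<^sub>z p(z)\<close> over distinct numbers is resolved into monomials: each coefficient depends
  polynomially on one of the numbers, and the space contains its values at all but finitely many
  places, hence the coefficients \<open>p\<^sub>l\<close> of this dependence.\<close>

lemma mod_space_any_p_factors:
  assumes "finite Z" "\<forall>r\<in>#R. r < card Z + size L"
  shows "fps_nth (var_series U R * var_series V L * eval_prod Z (\<lambda>_. 0)) N \<in> mod_space (card Z + size L) N"
  using assms
proof (induction L arbitrary: Z N)
  case empty
  then show ?case
    using mod_space_x_monomials[of Z R "\<lambda>_. 0" N] by (simp add: var_series_def)
next
  case (add l L)
  let ?k = "card Z + size (add_mset l L)"
  define F where "F = var_series U R * var_series V L * eval_prod Z (\<lambda>_. 0)"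
  have eq: "var_series U R * var_series V (add_mset l L) * eval_prod Z (\<lambda>_. 0) =
      fps_X ^ Suc l * (fps_const (mvar (V, l)) * F)"
    by (simp add: F_def var_series_add_mset mult_ac)
  show ?case
  proof (cases "N < Suc l")
    case True
    then show ?thesis
      unfolding eq fps_X_power_mult_nth using mp.subspace_0[OF subspace_mod_space] by simp
  next
    case False
    \<comment> \<open>\<open>N\<close> new points suffice: the coefficient at \<open>N\<close> has degree less than \<open>N\<close> in each of them\<close>
    have "infinite (UNIV - Z)"
      using add.prems(1) by (simp add: infinite_UNIV_char_0)
    then obtain Y where Y: "Y \<subseteq> UNIV - Z" "finite Y" "card Y = N"
      using infinite_arbitrarily_large by blast
    obtain w where w: "\<And>s. s < N \<Longrightarrow> (\<Sum>z\<in>Y. w z * z ^ s) = (if s = l then 1 else 0)"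
      using dual_vandermonde[OF Y(2), of l] False Y(3) by auto
    have "fps_nth (F * eval_series z V) N \<in> mod_space ?k N" if "z \<in> Y" for z
    proof -
      have z: "z \<notin> Z"
        using that Y by blast
      then have "eval_prod (insert z Z) (\<lambda>_. 0) = eval_prod Z (\<lambda>_. 0) * eval_series z V"
        using add.prems(1) by (simp add: eval_prod_def mult_ac)
      then have "F * eval_series z V = var_series U R * var_series V L * eval_prod (insert z Z) (\<lambda>_. 0)"
        by (simp add: F_def mult_ac)
      moreover have "card (insert z Z) + size L = ?k"
        using z add.prems(1) by simp
      ultimately show ?thesis
        using add.IH[of "insert z Z" N] add.prems by simp
    qed
    then have "(\<Sum>z\<in>Y. mscale (w z) (fps_nth (F * eval_series z V) N)) \<in> mod_space ?k N"
      by (intro mp.subspace_sum[OF subspace_mod_space] mp.subspace_scale[OF subspace_mod_space])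
    also have "(\<Sum>z\<in>Y. mscale (w z) (fps_nth (F * eval_series z V) N)) =
        mvar (V, l) * fps_nth F (N - Suc l)"
    proof -
      have nth: "fps_nth (F * eval_series z V) N =
          (\<Sum>s<N. mscale (z ^ s) (mvar (V, s) * fps_nth F (N - Suc s)))" for z
      proof -
        have "fps_nth (F * eval_series z V) N = fps_nth (eval_series z V * F) N"
          by (simp add: mult.commute)
        also have "\<dots> = (\<Sum>i\<le>N. fps_nth (eval_series z V) i * fps_nth F (N - i))"
          by (simp add: fps_mult_nth atMost_atLeast0)
        also have "\<dots> = (\<Sum>s<N. fps_nth (eval_series z V) (Suc s) * fps_nth F (N - Suc s))"
          by (cases N) (simp_all add: sum.atMost_Suc_shift eval_series_def lessThan_Suc_atMost
              del: sum.atMost_Suc sum.lessThan_Suc)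
        finally show ?thesis
          by (simp add: eval_series_def mscale_mult_left)
      qed
      have "(\<Sum>z\<in>Y. mscale (w z) (fps_nth (F * eval_series z V) N)) =
          (\<Sum>z\<in>Y. \<Sum>s<N. mscale (w z * z ^ s) (mvar (V, s) * fps_nth F (N - Suc s)))"
        by (simp add: nth mp.scale_sum_right mp.scale_scale)
      also have "\<dots> = (\<Sum>s<N. mscale (\<Sum>z\<in>Y. w z * z ^ s) (mvar (V, s) * fps_nth F (N - Suc s)))"
        by (subst sum.swap) (simp add: mp.scale_sum_left)
      also have "\<dots> = (\<Sum>s<N. if s = l then mvar (V, s) * fps_nth F (N - Suc s) else 0)"
        by (rule sum.cong) (simp_all add: w)
      also have "\<dots> = mvar (V, l) * fps_nth F (N - Suc l)"
        using False by simp
      finally show ?thesis .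
    qed
    finally show ?thesis
      unfolding eq fps_X_power_mult_nth using False by simp
  qed
qed

text \<open>The exponent vector of the monomial of a pair in \<open>standard_pairs\<close>.\<close>

definition monom_of :: "nat multiset \<Rightarrow> nat multiset \<Rightarrow> (uv \<times> nat \<Rightarrow>\<^sub>0 nat)" where
  "monom_of R L = (\<Sum>r\<in>#R. single (U, r) 1) + (\<Sum>l\<in>#L. single (V, l) 1)"

lemma lookup_monom_of: "lookup (monom_of R L) (x, r) = (case x of U \<Rightarrow> count R r | V \<Rightarrow> count L r)"
proof -
  have "lookup (\<Sum>r\<in>#M. single (y, r) 1) (x, r) = (if x = y then count M r else 0)" for M y
    by (induction M) (auto simp: lookup_add lookup_single when_def)
  then show ?thesis
    by (cases x) (simp_all add: monom_of_def lookup_add)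
qed

lemma monom_of_inject: "monom_of R L = monom_of R' L' \<longleftrightarrow> R = R' \<and> L = L'"
proof
  assume eq: "monom_of R L = monom_of R' L'"
  have "count R r = count R' r" "count L r = count L' r" for r
    using arg_cong[OF eq, of "\<lambda>m. lookup m (U, r)"] arg_cong[OF eq, of "\<lambda>m. lookup m (V, r)"]
    by (simp_all add: lookup_monom_of)
  then show "R = R' \<and> L = L'"
    by (simp add: multiset_eq_iff)
qed simp

lemma monom_of_surj: "\<exists>R L. m = monom_of R L"
proof (induction m rule: poly_mapping_single_induct)
  case (single y n)
  obtain x r where y: "y = (x, r)"
    by fastforce
  have rep: "single y n = (\<Sum>r\<in>#replicate_mset n r. single (x, r) 1)"
    unfolding y
  proof (induction n)
    case (Suc n)
    have "single (x, r) (Suc n) = single (x, r) 1 + single (x, r) n"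
      by (simp flip: single_add)
    then show ?case
      using Suc by simp
  qed simp
  show ?case
  proof (cases x)
    case U
    then have "single y n = monom_of (replicate_mset n r) {#}"
      using rep by (simp add: monom_of_def)
    then show ?thesis by blast
  next
    case V
    then have "single y n = monom_of {#} (replicate_mset n r)"
      using rep by (simp add: monom_of_def)
    then show ?thesis by blast
  qed
next
  case (add m n)
  then obtain R L R' L' where "m = monom_of R L" "n = monom_of R' L'"
    by blast
  then have "m + n = monom_of (R + R') (L + L')"
    by (simp add: monom_of_def add_ac)
  then show ?case by blast
qed

lemma wdegree_monom_of:
  "wdegree deg_wt (monom_of R L) = (\<Sum>r\<in>#R. Suc r) + (\<Sum>l\<in>#L. Suc l)"
  "wdegree V_wt (monom_of R L) = size L"
proof -
  have "wdegree deg_wt (\<Sum>r\<in>#M. single (x, r) 1) = (\<Sum>r\<in>#M. Suc r)"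
    "wdegree V_wt (\<Sum>r\<in>#M. single (x, r) 1) = (if x = V then size M else 0)" for M x
    by (induction M) (simp_all add: wdegree_add)
  then show "wdegree deg_wt (monom_of R L) = (\<Sum>r\<in>#R. Suc r) + (\<Sum>l\<in>#L. Suc l)"
    "wdegree V_wt (monom_of R L) = size L"
    by (simp_all add: monom_of_def wdegree_add)
qed

lemma standard_monom_of: "standard k (monom_of R L) \<longleftrightarrow> size L = k \<and> (\<forall>r\<in>#R. r < k)"
  by (auto simp: standard_def wdegree_monom_of in_keys_iff lookup_monom_of)

lemma var_series_eq:
  "var_series x M = fps_const (single (\<Sum>r\<in>#M. single (x, r) 1) 1) * fps_X ^ (\<Sum>r\<in>#M. Suc r)"
proof (induction M)
  case empty
  show ?case
    by (simp add: var_series_def)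
next
  case (add r M)
  have "fps_const (single (single (x, r) 1 + m) 1) =
      fps_const (mvar (x, r)) * fps_const (single m 1)" for m
    by (simp add: mvar_def mult_single)
  then show ?case
    by (simp add: var_series_add_mset add power_add mult_ac)
qed

text \<open>The case of no evaluation points left in \<open>mod_space_any_p_factors\<close>.\<close>

lemma standard_monomial_lift:
  assumes "(R, L) \<in> standard_pairs N"
  shows "\<exists>g\<in>gen_space (size L) N. \<forall>m. standard (size L) m \<longrightarrow>
    lookup g m = (if m = monom_of R L then 1 else 0)"
proof -
  have N: "(\<Sum>r\<in>#R. Suc r) + (\<Sum>l\<in>#L. Suc l) = N"
    using assms by (simp add: standard_pairs_def)
  have "var_series U R * var_series V L * eval_prod {} (\<lambda>_. 0) =
      fps_const (single (monom_of R L) 1) * fps_X ^ N"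
    by (simp add: eval_prod_def var_series_eq monom_of_def mult_single power_add mult_ac flip: N
        fps_const_mult)
  then have "single (monom_of R L) 1 = fps_nth (var_series U R * var_series V L * eval_prod {} (\<lambda>_. 0)) N"
    by (simp add: fps_X_power_mult_right_nth)
  also have "\<dots> \<in> mod_space (card ({} :: complex set) + size L) N"
    by (rule mod_space_any_p_factors) (use assms in \<open>auto simp: standard_pairs_def\<close>)
  finally obtain g where g: "g \<in> gen_space (size L) N" "single (monom_of R L) 1 - g \<in> high_ideal (size L)"
    by (auto simp: mod_space_def)
  have "lookup g m = (if m = monom_of R L then 1 else 0)" if "standard (size L) m" for m
    using lookup_high_ideal[OF g(2) that] by (auto simp: lookup_minus lookup_single when_def split: if_splits)
  then show ?thesis
    using g(1) by blast
qed

section \<open>Change of variables\<close>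

text \<open>\<open>to_xp\<close> rewrites a polynomial in \<open>u\<close>, \<open>v\<close> in the coordinates \<open>x = u\<close>, \<open>p = u + v\<close>.\<close>

definition to_xp_var :: "uv \<times> nat \<Rightarrow> (uv \<times> nat) mpoly" where
  "to_xp_var = (\<lambda>(x, r). case x of U \<Rightarrow> mvar (U, r) | V \<Rightarrow> mvar (V, r) - mvar (U, r))"

definition from_xp_var :: "uv \<times> nat \<Rightarrow> (uv \<times> nat) mpoly" where
  "from_xp_var = (\<lambda>(x, r). case x of U \<Rightarrow> mvar (U, r) | V \<Rightarrow> mvar (V, r) + mvar (U, r))"

definition to_xp :: "(uv \<times> nat) mpoly \<Rightarrow> (uv \<times> nat) mpoly" where
  "to_xp = msubst mconst to_xp_var"

definition from_xp :: "(uv \<times> nat) mpoly \<Rightarrow> (uv \<times> nat) mpoly" where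
  "from_xp = msubst mconst from_xp_var"

lemma to_xp_from_xp: "to_xp (from_xp p) = p"
  by (induction p rule: mpoly_induct)
    (auto simp: to_xp_def from_xp_def mconst.msubst_simps to_xp_var_def from_xp_var_def split: prod.split uv.split)

lemma from_xp_to_xp: "from_xp (to_xp p) = p"
  by (induction p rule: mpoly_induct)
    (auto simp: to_xp_def from_xp_def mconst.msubst_simps mconst.msubst_diff to_xp_var_def from_xp_var_def
      split: prod.split uv.split)

lemma homogeneous_to_xp: "homogeneous deg_wt N p \<Longrightarrow> homogeneous deg_wt N (to_xp p)"
  and homogeneous_from_xp: "homogeneous deg_wt N p \<Longrightarrow> homogeneous deg_wt N (from_xp p)"
proof -
  have "homogeneous deg_wt (deg_wt y) (to_xp_var y)" "homogeneous deg_wt (deg_wt y) (from_xp_var y)" for y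
  proof -
    obtain x r where y: "y = (x, r)"
      by fastforce
    have "homogeneous deg_wt (Suc r) (mvar (x, r))" for x
      using homogeneous_mvar[of deg_wt "(x, r)"] by simp
    then show "homogeneous deg_wt (deg_wt y) (to_xp_var y)" "homogeneous deg_wt (deg_wt y) (from_xp_var y)"
      unfolding y to_xp_var_def from_xp_var_def
      by (cases x; simp add: homogeneous_add homogeneous_diff)+
  qed
  then show "homogeneous deg_wt N p \<Longrightarrow> homogeneous deg_wt N (to_xp p)"
    "homogeneous deg_wt N p \<Longrightarrow> homogeneous deg_wt N (from_xp p)"
    unfolding to_xp_def from_xp_def by (blast intro: homogeneous_msubst)+
qed

lemma affine_supersym_component_iff:
  "f \<in> affine_supersym_component N \<longleftrightarrow> f \<in> affine_supersym \<and> homogeneous deg_wt N f"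
  by (simp add: affine_supersym_component_def)

lemma prod_keys_uv:
  fixes f :: "uv \<Rightarrow> 'a::comm_monoid_mult"
  shows "(\<Prod>x\<in>keys m. f x ^ lookup m x) = f U ^ lookup m U * f V ^ lookup m V"
proof -
  have "keys m \<subseteq> {U, V}"
    using uv.exhaust by auto
  then have "(\<Prod>x\<in>keys m. f x ^ lookup m x) = (\<Prod>x\<in>{U, V}. f x ^ lookup m x)"
    by (intro prod.mono_neutral_left) (auto simp: in_keys_iff)
  then show ?thesis
    by simp
qed

lemma poly_mapping_uv_eqI: "lookup m U = lookup n U \<Longrightarrow> lookup m V = lookup n V \<Longrightarrow> m = n"
  by (rule poly_mapping_eqI) (metis uv.exhaust)

definition all_span :: "(uv \<times> nat) mpoly set" where
  "all_span = mp.span {f. \<exists>k N. gen_prod k N f}"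

lemma all_span_mult:
  assumes "f \<in> all_span" "g \<in> all_span"
  shows "f * g \<in> all_span"
  using assms(1) unfolding all_span_def
proof (induction rule: mp.span_induct_alt)
  case (step c f1 f2)
  then obtain k M where f1: "gen_prod k M f1"
    by auto
  have "f1 * g \<in> mp.span {f. \<exists>k N. gen_prod k N f}"
    using assms(2) unfolding all_span_def
  proof (induction rule: mp.span_induct_alt)
    case (step d g1 g2)
    then obtain l N where "gen_prod l N g1"
      by auto
    then have "f1 * g1 \<in> {f. \<exists>k N. gen_prod k N f}"
      using gen_prod_mult[OF f1] by blast
    then show ?case
      using step by (simp add: distrib_left mscale_mult_right mp.span_add mp.span_scale mp.span_base)
  qed (simp add: mp.span_zero)
  then show ?case
    using step by (simp add: distrib_right mscale_mult_left mp.span_add mp.span_scale)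
qed (simp add: mp.span_zero)

lemma all_span_mconst: "mconst c \<in> all_span"
proof -
  have "mscale c 1 \<in> all_span"
    unfolding all_span_def by (intro mp.span_scale mp.span_base) (auto intro: gen_prod_1)
  then show ?thesis
    by (simp add: mscale_def)
qed

lemma subspace_all_span: "mp.subspace all_span"
  by (simp add: all_span_def)

lemma gen_space_subset_all_span: "gen_space k N \<subseteq> all_span"
  unfolding gen_space_def all_span_def by (rule mp.span_mono) auto

lemma gen_coeff_all_span: "gen_coeff a r \<in> all_span"
  unfolding all_span_def using gen_prod_gen_coeff by (intro mp.span_base) blast

lemma all_span_fps_mult:
  assumes "\<And>N. fps_nth F N \<in> all_span" "\<And>N. fps_nth G N \<in> all_span"
  shows "fps_nth (F * G) N \<in> all_span"
  unfolding fps_mult_nth by (intro mp.subspace_sum[OF subspace_all_span] all_span_mult assms)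

text \<open>In the coordinates \<open>x\<close>, \<open>p\<close>, restricting to \<open>u = t\<close>, \<open>v = -t\<close> means to put \<open>p = 0\<close>. So for a
  supersymmetric polynomial each nonconstant monomial is \<open>p\<^sup>b (p x\<^sup>a)\<close>, and every factor is a
  generating series.\<close>

lemma to_xp_affine_coeff:
  assumes "P \<in> supersym"
  shows "to_xp (affine_coeff P r) \<in> all_span"
proof -
  define Q where "Q = msubst mconst (\<lambda>x. case x of U \<Rightarrow> mvar U | V \<Rightarrow> mvar V - mvar U) P"
  let ?s = "msubst (\<lambda>a. fps_const (mconst a)) gen_series"
  have T: "mconst.msubst_fps to_xp_var (gen_series U) = gen_series U"
    "mconst.msubst_fps to_xp_var (gen_series V) = gen_series V - gen_series U"
    by (rule fps_ext, simp add: gen_series_def mconst.msubst_mvar to_xp_var_def)+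
  have lift: "mconst.msubst_fps to_xp_var (?s P) = ?s Q"
    unfolding Q_def
  proof (induction P rule: mpoly_induct)
    case (const c)
    show ?case
      by (rule fps_ext) (simp add: mconst.msubst_mconst fps_mconst.msubst_mconst mconst.msubst_0)
  next
    case (var x)
    show ?case
      by (cases x) (simp_all add: T mconst.msubst_mvar fps_mconst.msubst_mvar fps_mconst.msubst_diff)
  qed (simp_all add: mconst.msubst_simps fps_mconst.msubst_simps mconst.msubst_fps_add mconst.msubst_fps_mult)
  have eq: "to_xp (affine_coeff P r) = fps_nth (?s Q) r"
    unfolding to_xp_def affine_coeff_def by (simp flip: lift)
  obtain c where c: "msubst (\<lambda>a. [:a:]) (\<lambda>x. case x of U \<Rightarrow> [:0, 1:] | V \<Rightarrow> - [:0, 1:]) P = [:c:]"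
    using assms unfolding supersym_def by blast
  let ?e = "msubst (\<lambda>a. [:a:]) (\<lambda>x. case x of U \<Rightarrow> [:0, 1:] | V \<Rightarrow> 0)"
  have "?e Q = msubst (\<lambda>a. [:a:]) (\<lambda>x. case x of U \<Rightarrow> [:0, 1:] | V \<Rightarrow> - [:0, 1:]) P"
    unfolding Q_def
    by (induction P rule: mpoly_induct)
      (simp_all add: mconst.msubst_simps poly_const.msubst_simps poly_const.msubst_diff split: uv.split)
  then have eQ: "?e Q = [:c:]"
    using c by simp
  have coeff: "coeff (?e p) n = lookup p (single U n)" for p :: "uv mpoly" and n
  proof (induction p rule: poly_mapping_single_induct)
    case (single m d)
    have "?e (single m d) = [:d:] * ([:0, 1:] ^ lookup m U * 0 ^ lookup m V)"
      by (simp add: poly_const.msubst_single poly_const.eval_monom_def prod_keys_uv)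
    moreover have "m = single U n \<longleftrightarrow> lookup m U = n \<and> lookup m V = 0"
      using poly_mapping_uv_eqI[of m "single U n"] by (auto simp: lookup_single)
    ultimately show ?case
      by (auto simp: lookup_single when_def power_0_left simp flip: monom_altdef[of 1, simplified])
  qed (simp add: poly_const.msubst_add lookup_add)
  have keys: "m = 0 \<or> lookup m V > 0" if "m \<in> keys Q" for m
  proof (rule ccontr)
    assume "\<not> ?thesis"
    then have m: "lookup m V = 0" "lookup m U \<noteq> 0"
      using poly_mapping_uv_eqI[of m 0] by auto
    then have "m = single U (lookup m U)"
      by (intro poly_mapping_uv_eqI) (auto simp: lookup_single)
    then have "lookup Q m = coeff [:c:] (lookup m U)"
      using coeff[of Q "lookup m U"] eQ by simp
    then show False
      using m that by (simp add: in_keys_iff coeff_pCons split: nat.splits)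
  qed
  have summand: "fps_nth (fps_const (mconst d) * (gen_series U ^ lookup m U * gen_series V ^ lookup m V)) r \<in> all_span"
    if "m \<in> keys Q" for m d
  proof (cases "m = 0")
    case True
    then show ?thesis
      using all_span_mconst mp.subspace_0[OF subspace_all_span] by simp
  next
    case False
    then obtain b where b: "lookup m V = Suc b"
      using keys[OF \<open>m \<in> keys Q\<close>] gr0_implies_Suc by blast
    let ?a = "lookup m U"
    have V: "fps_nth (gen_series V) N \<in> all_span" for N
      using gen_coeff_all_span[of 0 N] by (simp add: gen_coeff_def)
    have one: "fps_nth 1 N \<in> all_span" for N
      using one_gen_space gen_space_subset_all_span by blast
    have "fps_nth (gen_series V ^ b) N \<in> all_span" for N
      by (induction b arbitrary: N) (simp_all only: power_0 power_Suc one V all_span_fps_mult)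
    moreover have "fps_nth (gen_series V * gen_series U ^ ?a) N \<in> all_span" for N
      using gen_coeff_all_span[of ?a N] by (simp add: gen_coeff_def)
    ultimately have "fps_nth (gen_series V ^ b * (gen_series V * gen_series U ^ ?a)) r \<in> all_span"
      by (rule all_span_fps_mult)
    moreover have "gen_series U ^ ?a * gen_series V ^ lookup m V =
        gen_series V ^ b * (gen_series V * gen_series U ^ ?a)"
      by (simp add: b mult_ac)
    ultimately show ?thesis
      unfolding fps_nth_mscale_const by (simp add: mp.subspace_scale[OF subspace_all_span])
  qed
  have "fps_nth (?s Q) r = (\<Sum>m\<in>keys Q. fps_nth (fps_const (mconst (lookup Q m)) *
      (gen_series U ^ lookup m U * gen_series V ^ lookup m V)) r)"
    by (simp add: msubst_def prod_keys_uv fps_sum_nth)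
  then show ?thesis
    unfolding eq using summand by (simp add: mp.subspace_sum[OF subspace_all_span])
qed

lemma to_xp_affine_supersym: "f \<in> affine_supersym \<Longrightarrow> to_xp f \<in> all_span"
proof (induction rule: affine_supersym.induct)
  case (gen P r)
  then show ?case by (rule to_xp_affine_coeff)
qed (simp_all add: to_xp_def mconst.msubst_simps all_span_mconst all_span_mult
    mp.subspace_add[OF subspace_all_span])

lemma from_xp_gen_coeff: "from_xp (gen_coeff a r) \<in> affine_supersym"
proof -
  define P where "P = (mvar U + mvar V) * mvar U ^ a"
  have "P \<in> supersym"
    by (auto simp: P_def supersym_def poly_const.msubst_simps intro: exI[of _ 0])
  moreover have "affine_coeff P r = from_xp (gen_coeff a r)"
  proof -
    have "mconst.msubst_fps from_xp_var (gen_series U) = gen_series U"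
      "mconst.msubst_fps from_xp_var (gen_series V) = gen_series U + gen_series V"
      by (rule fps_ext, simp add: gen_series_def mconst.msubst_mvar from_xp_var_def)+
    then have "mconst.msubst_fps from_xp_var (gen_series V * gen_series U ^ a) =
        (gen_series U + gen_series V) * gen_series U ^ a"
      by (simp add: mconst.msubst_fps_mult mconst.msubst_fps_power)
    then have "from_xp (gen_coeff a r) = fps_nth ((gen_series U + gen_series V) * gen_series U ^ a) r"
      unfolding from_xp_def gen_coeff_def by (metis mconst.msubst_fps_nth)
    then show ?thesis
      by (simp add: affine_coeff_def P_def fps_mconst.msubst_simps fps_mconst.msubst_power)
  qed
  ultimately show ?thesis
    using affine_supersym.gen by metis
qed

lemma subspace_affine_supersym: "mp.subspace affine_supersym"
proof (rule mp.subspaceI)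
  show "0 \<in> affine_supersym"
    using affine_supersym.const[of 0] by simp
qed (auto simp: mscale_def intro: affine_supersym.intros)

lemma from_xp_gen_space: "f \<in> gen_space k N \<Longrightarrow> from_xp f \<in> affine_supersym"
proof -
  have prod: "from_xp f \<in> affine_supersym" if "gen_prod k N f" for f
    using that
  proof (induction)
    case gen_prod_1
    show ?case
      using affine_supersym.const[of 1] by (simp add: from_xp_def mconst.msubst_1)
  next
    case (gen_prod_step k N f a r)
    then show ?case
      using affine_supersym.mult[OF from_xp_gen_coeff] by (simp add: from_xp_def mconst.msubst_mult)
  qed
  assume "f \<in> gen_space k N"
  then show ?thesis
    unfolding gen_space_def
  proof (induction rule: mp.span_induct_alt)
    case base
    show ?case
      using mp.subspace_0[OF subspace_affine_supersym] by (simp add: from_xp_def mconst.msubst_0)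
  next
    case (step c f g)
    then show ?case
      using prod[of f] mp.subspace_scale[OF subspace_affine_supersym] mp.subspace_add[OF subspace_affine_supersym]
      by (simp add: from_xp_def mconst.msubst_add mconst.msubst_mscale flip: mscale_def)
  qed
qed

text \<open>The projection \<open>H\<close> to the homogeneous part of degree \<open>N\<close> keeps a product of generators or kills it.\<close>

lemma all_span_decompose:
  assumes "f \<in> all_span" "homogeneous deg_wt N f"
  shows "\<exists>h K. (\<forall>k. h k \<in> gen_space k N) \<and> f = (\<Sum>k\<le>K. h k)"
proof -
  define H where "H f = (\<Sum>m\<in>keys f. if wdegree deg_wt m = N then single m (lookup f m) else 0)"
    for f :: "(uv \<times> nat) mpoly"
  have lookup_H: "lookup (H f) m = (if wdegree deg_wt m = N then lookup f m else 0)" for f m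
  proof -
    have "lookup (H f) m = (\<Sum>n\<in>keys f. if n = m then (if wdegree deg_wt m = N then lookup f m else 0) else 0)"
      unfolding H_def lookup_sum by (rule sum.cong) (auto simp: lookup_single when_def)
    then show ?thesis
      by (simp add: in_keys_iff)
  qed
  have H_add: "H (f + g) = H f + H g" and H_scale: "H (mscale c f) = mscale c (H f)"
    for f g :: "(uv \<times> nat) mpoly" and c
    by (rule poly_mapping_eqI, simp add: lookup_H lookup_add)+
  have H_0: "H 0 = 0"
    by (simp add: H_def)
  have H_hom: "H f = (if M = N then f else 0)" if "homogeneous deg_wt M f" for f M
    using homogeneousD[OF that] by (intro poly_mapping_eqI) (auto simp: lookup_H)
  have "\<exists>h K. (\<forall>k. h k \<in> gen_space k N) \<and> H f = (\<Sum>k\<le>K. h k)"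
    using assms(1) unfolding all_span_def
  proof (induction rule: mp.span_induct_alt)
    case base
    then show ?case
      using mp.subspace_0[OF subspace_gen_space] by (intro exI[of _ "\<lambda>_. 0"]) (simp add: H_0)
  next
    case (step c f g)
    obtain l M where f: "gen_prod l M f"
      using step by auto
    obtain h K where h: "\<And>k. h k \<in> gen_space k N" "H g = (\<Sum>k\<le>K. h k)"
      using step by blast
    define e where "e k = (if k = l then mscale c (H f) else 0)" for k
    define h' where "h' k = e k + (if k \<le> K then h k else 0)" for k
    have "H f \<in> gen_space l N"
      using H_hom[OF homogeneous_gen_prod(1)[OF f]] f mp.span_base[of f "{f. gen_prod l N f}"]
        mp.subspace_0[OF subspace_gen_space] by (auto simp: gen_space_def)
    then have "\<forall>k. h' k \<in> gen_space k N"
      using h(1) mp.subspace_0[OF subspace_gen_space] unfolding h'_def e_def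
      by (auto intro!: mp.subspace_add[OF subspace_gen_space] mp.subspace_scale[OF subspace_gen_space])
    moreover have "H (mscale c f + g) = (\<Sum>k\<le>max K l. h' k)"
    proof -
      have "(\<Sum>k\<le>max K l. e k) = mscale c (H f)"
        by (simp add: e_def)
      moreover have "(\<Sum>k\<le>max K l. if k \<le> K then h k else 0) = (\<Sum>k\<le>K. h k)"
        by (rule sum.mono_neutral_cong_right) auto
      ultimately show ?thesis
        by (simp add: H_add H_scale h(2) h'_def sum.distrib)
    qed
    ultimately show ?case
      by blast
  qed
  then show ?thesis
    using H_hom[OF assms(2)] by simp
qed

section \<open>The dimensions\<close>

text \<open>The parts with different numbers of factors \<open>p\<close> do not share monomials, so each of them has vanishing
  standard coefficients.\<close>

lemma affine_component_eq_0I: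
  assumes "f \<in> affine_supersym_component N"
    "\<And>R L. (R, L) \<in> standard_pairs N \<Longrightarrow> lookup (to_xp f) (monom_of R L) = 0"
  shows "f = 0"
proof -
  have f: "to_xp f \<in> all_span" "homogeneous deg_wt N (to_xp f)"
    using assms(1) to_xp_affine_supersym homogeneous_to_xp
    unfolding affine_supersym_component_iff by blast+
  obtain h K where h: "\<And>k. h k \<in> gen_space k N" "to_xp f = (\<Sum>k\<le>K. h k)"
    using all_span_decompose[OF f] by blast
  have "h k = 0" if "k \<le> K" for k
  proof (rule gen_span_eq_0I)
    show "h k \<in> gen_span k"
      using h(1) gen_space_subset_gen_span by blast
    fix m assume m: "standard k m"
    show "lookup (h k) m = 0"
    proof (cases "wdegree deg_wt m = N")
      case False
      then show ?thesis
        using homogeneousD[OF homogeneous_gen_space(1)[OF h(1)[of k]], of m] by blast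
    next
      case True
      obtain R L where mm: "m = monom_of R L"
        using monom_of_surj by blast
      then have "(R, L) \<in> standard_pairs N"
        using m True by (auto simp: standard_pairs_def standard_monom_of wdegree_monom_of)
      then have "0 = lookup (\<Sum>k\<le>K. h k) m"
        using assms(2) h(2) mm by simp
      also have "\<dots> = (\<Sum>k'\<le>K. if k' = k then lookup (h k) m else 0)"
        unfolding lookup_sum
      proof (rule sum.cong[OF refl])
        fix k'
        show "lookup (h k') m = (if k' = k then lookup (h k) m else 0)"
          using homogeneousD[OF homogeneous_gen_space(2)[OF h(1)[of k']], of m] m
          by (auto simp: standard_def)
      qed
      also have "\<dots> = lookup (h k) m"
        using that by simp
      finally show ?thesis by simp
    qed
  qed
  then have "to_xp f = 0"
    by (simp add: h(2))
  then show ?thesis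
    using from_xp_to_xp[of f] by (simp add: from_xp_def mconst.msubst_0)
qed

lemma affine_component_dual:
  assumes "(R, L) \<in> standard_pairs N"
  shows "\<exists>f\<in>affine_supersym_component N. \<forall>R' L'. (R', L') \<in> standard_pairs N \<longrightarrow>
    lookup (to_xp f) (monom_of R' L') = (if (R', L') = (R, L) then 1 else 0)"
proof -
  obtain g where g: "g \<in> gen_space (size L) N"
    "\<And>m. standard (size L) m \<Longrightarrow> lookup g m = (if m = monom_of R L then 1 else 0)"
    using standard_monomial_lift[OF assms] by blast
  have "lookup g (monom_of R' L') = (if (R', L') = (R, L) then 1 else 0)"
    if "(R', L') \<in> standard_pairs N" for R' L'
  proof (cases "size L' = size L")
    case True
    then have "standard (size L) (monom_of R' L')"
      using that by (simp add: standard_monom_of standard_pairs_def)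
    then show ?thesis
      by (simp add: g(2) monom_of_inject)
  next
    case False
    then show ?thesis
      using homogeneousD[OF homogeneous_gen_space(2)[OF g(1)], of "monom_of R' L'"]
      by (auto simp: wdegree_monom_of)
  qed
  moreover have "from_xp g \<in> affine_supersym_component N"
    unfolding affine_supersym_component_iff
    using from_xp_gen_space[OF g(1)] homogeneous_from_xp[OF homogeneous_gen_space(1)[OF g(1)]] by blast
  ultimately show ?thesis
    by (intro bexI[of _ "from_xp g"]) (simp_all add: to_xp_from_xp)
qed

text \<open>The vectors \<open>b s\<close> form the basis dual to the separating family of functionals \<open>\<phi> s\<close>.\<close>

lemma (in vector_space) dim_eq_card_dual:
  assumes V: "subspace W" and S: "finite S"
    and lin: "\<And>s x y. \<phi> s (x + y) = \<phi> s x + \<phi> s y" "\<And>s c x. \<phi> s (scale c x) = c * \<phi> s x"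
    and dual: "\<And>s. s \<in> S \<Longrightarrow> b s \<in> W" "\<And>s t. s \<in> S \<Longrightarrow> t \<in> S \<Longrightarrow> \<phi> t (b s) = (if t = s then 1 else 0)"
    and inj: "\<And>x. x \<in> W \<Longrightarrow> (\<And>s. s \<in> S \<Longrightarrow> \<phi> s x = 0) \<Longrightarrow> x = 0"
  shows "dim W = card S"
proof -
  have \<phi>0: "\<phi> s 0 = 0" for s
    using lin(2)[of s 0 0] by simp
  have \<phi>sum: "\<phi> s (\<Sum>i\<in>I. x i) = (\<Sum>i\<in>I. \<phi> s (x i))" for s I and x :: "'i \<Rightarrow> 'b"
    by (induction I rule: infinite_finite_induct) (simp_all add: \<phi>0 lin)
  have \<phi>lin: "\<phi> t (\<Sum>s\<in>S. scale (c s) (b s)) = c t" if "t \<in> S" for t c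
    using that S by (simp add: \<phi>sum lin(2) dual(2) if_distrib[of "(*) _"] cong: if_cong)
  have b_inj: "inj_on b S"
    by (rule inj_onI) (metis dual(2) zero_neq_one)
  have "dim W = card (b ` S)"
  proof (rule dim_unique)
    show "b ` S \<subseteq> W"
      using dual(1) by blast
    show "W \<subseteq> span (b ` S)"
    proof
      fix x assume x: "x \<in> W"
      define y where "y = (\<Sum>s\<in>S. scale (\<phi> s x) (b s))"
      have y: "y \<in> W"
        unfolding y_def using dual(1) by (intro subspace_sum[OF V] subspace_scale[OF V])
      have "x + scale (- 1) y \<in> W"
        using V x y by (intro subspace_add subspace_scale)
      moreover have "\<phi> s (x + scale (- 1) y) = 0" if "s \<in> S" for s
        unfolding lin y_def \<phi>lin[OF that] by simp
      ultimately have "x + scale (- 1) y = 0"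
        by (rule inj)
      then have "x = y"
        by simp
      also have "y \<in> span (b ` S)"
        unfolding y_def by (intro span_sum span_scale span_base) simp
      finally show "x \<in> span (b ` S)" .
    qed
    show "independent (b ` S)"
    proof (rule independent_if_scalars_zero)
      fix c x assume c: "(\<Sum>x\<in>b ` S. scale (c x) x) = 0" "x \<in> b ` S"
      then obtain s where s: "s \<in> S" "x = b s"
        by blast
      have "(\<Sum>s\<in>S. scale (c (b s)) (b s)) = 0"
        using c(1) b_inj by (simp add: sum.reindex)
      then show "c x = 0"
        using \<phi>lin[OF s(1), of "\<lambda>s. c (b s)"] by (simp add: \<phi>0 s(2))
    qed (use S in simp)
  qed simp
  then show ?thesis
    using b_inj by (simp add: card_image)
qed

lemma dim_affine_supersym_component:
  "mp.dim (affine_supersym_component N) = card (standard_pairs N)"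
proof -
  define \<phi> where "\<phi> = (\<lambda>(R, L) f. lookup (to_xp f) (monom_of R L))"
  have "\<forall>s\<in>standard_pairs N. \<exists>f\<in>affine_supersym_component N. \<forall>t\<in>standard_pairs N.
      \<phi> t f = (if t = s then 1 else 0)"
    using affine_component_dual unfolding \<phi>_def by fastforce
  then obtain b where b: "\<And>s. s \<in> standard_pairs N \<Longrightarrow> b s \<in> affine_supersym_component N"
    "\<And>s t. s \<in> standard_pairs N \<Longrightarrow> t \<in> standard_pairs N \<Longrightarrow> \<phi> t (b s) = (if t = s then 1 else 0)"
    by metis
  show ?thesis
  proof (rule mp.dim_eq_card_dual[where \<phi> = \<phi> and b = b])
    have "affine_supersym_component N = affine_supersym \<inter> {p. homogeneous deg_wt N p}"
      by (auto simp: affine_supersym_component_iff)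
    then show "mp.subspace (affine_supersym_component N)"
      using mp.subspace_inter[OF subspace_affine_supersym subspace_homogeneous] by simp
    show "finite (standard_pairs N)"
      by (rule finite_standard_pairs)
    show "\<phi> s (x + y) = \<phi> s x + \<phi> s y" "\<phi> s (mscale c x) = c * \<phi> s x" for s x y c
      by (simp_all add: \<phi>_def to_xp_def mconst.msubst_add mconst.msubst_mscale lookup_add
          flip: mscale_def split: prod.split)
    show "x = 0" if "x \<in> affine_supersym_component N" "\<And>s. s \<in> standard_pairs N \<Longrightarrow> \<phi> s x = 0" for x
      using affine_component_eq_0I[OF that(1)] that(2) by (auto simp: \<phi>_def)
  qed (use b in auto)
qed

theorem theoremC:
  shows "hilbert_series = 1 / qpoch_inf * suminf (\<lambda>k. fps_X ^ (k ^ 2 + k) / qpoch k ^ 2) \<and>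
    hilbert_series = plane_partition_series \<and>
    hilbert_series = 1 / qpoch_inf ^ 2 * suminf (\<lambda>k. (- 1) ^ k * fps_X ^ ((k ^ 2 + k) div 2))"
proof -
  have "hilbert_series = hook_series"
    unfolding hilbert_series_def dim_affine_supersym_component by (rule standard_pairs_series)
  then show ?thesis
    using hook_series_eq_durfee hook_series_eq_alternating plane_partition_series_eq by simp
qed

end
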